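(* Let $A$ be a low c.e. set. Then almost every set (with respect to the uniform measure on $2^\omega$) computes a set that is weakly $1$-generic relative to $A$; hence $A$ is dispersive.
   Context: $A$ is low if $A'\equiv_T\emptyset'$. A set $G$ is weakly $1$-generic relative to $A$ if $G$ has an initial segment in every dense set of binary strings that is c.e. relative to $A$. For $X\subseteq\omega$, $\rho_n(X)=|X\cap[0,n)|/n$, $\overline{\rho}(X)=\limsup_n\rho_n(X)$; coarse similarity classes $[X]$ (where $X\sim Y$ iff $\lim_n\rho_n(X\bigtriangleup Y)=0$) form the metric space $(\mathcal{S},\delta)$ with $\delta([X],[Y])=\overline{\rho}(X\bigtriangleup Y)$. $H(A,B)$ is the Hausdorff distance in $(\mathcal{S},\delta)$ between the closures of $\{[X]:X\le_T A\}$ and $\{[X]:X\le_T B\}$. $A$ is dispersive if the class of $B$ with $H(A,B)=1/2$ does not have measure $1$. *)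

theory Defs
  imports
    "HOL-Probability.Probability"
    "HOL-Library.Nat_Bijection"
    "HOL-Library.Sublist"
begin

section \<open>Computability relative to an oracle\<close>

text \<open>
  Kleene's partial recursive functions relative to an oracle set.  All functions are unary;
  several arguments are packed into one by the Cantor pairing function \<^const>\<open>prod_encode\<close>,
  whose projections \<open>Left\<close> and \<open>Right\<close> are therefore basic functions.
\<close>

datatype code =
    Zero
  | Succ
  | Left
  | Right
  | Oracle
  | Pairing code code
  | Comp code code
  | Prec code code
  | Mu code

text \<open>
  \<open>computes A c x y\<close> means that the program \<open>c\<close> with oracle \<open>A\<close> halts on input \<open>x\<close> with output \<open>y\<close>.
  \<open>Prec f g\<close> is primitive recursion, \<open>h (a, 0) = f a\<close> and \<open>h (a, n + 1) = g (a, (n, h (a, n)))\<close>.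
  \<open>Mu f\<close> is unbounded search: its value at \<open>a\<close> is the least \<open>n\<close> with \<open>f (a, n) = 0\<close>,
  provided that \<open>f (a, m)\<close> is defined for all \<open>m < n\<close>.
\<close>

inductive computes :: "nat set \<Rightarrow> code \<Rightarrow> nat \<Rightarrow> nat \<Rightarrow> bool" for A where
  Zero: "computes A Zero x 0"
| Succ: "computes A Succ x (Suc x)"
| Left: "computes A Left x (fst (prod_decode x))"
| Right: "computes A Right x (snd (prod_decode x))"
| Oracle: "computes A Oracle x (if x \<in> A then 1 else 0)"
| Pairing: "computes A f x y \<Longrightarrow> computes A g x z \<Longrightarrow>
    computes A (Pairing f g) x (prod_encode (y, z))"
| Comp: "computes A g x y \<Longrightarrow> computes A f y z \<Longrightarrow> computes A (Comp f g) x z"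
| Prec_0: "computes A f a y \<Longrightarrow> computes A (Prec f g) (prod_encode (a, 0)) y"
| Prec_Suc: "computes A (Prec f g) (prod_encode (a, n)) y \<Longrightarrow>
    computes A g (prod_encode (a, prod_encode (n, y))) z \<Longrightarrow>
    computes A (Prec f g) (prod_encode (a, Suc n)) z"
| Mu: "computes A f (prod_encode (a, n)) 0 \<Longrightarrow>
    (\<forall>m<n. \<exists>k. computes A f (prod_encode (a, m)) (Suc k)) \<Longrightarrow> computes A (Mu f) a n"

inductive_cases computes_elims:
  "computes A Zero x y"
  "computes A Succ x y"
  "computes A Left x y"
  "computes A Right x y"
  "computes A Oracle x y"
  "computes A (Pairing f g) x y"
  "computes A (Comp f g) x y"
  "computes A (Prec f g) x y"
  "computes A (Mu f) x y"

lemma computes_deterministic: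
  "computes A c x y \<Longrightarrow> computes A c x z \<Longrightarrow> y = z"
proof (induction arbitrary: z rule: computes.induct)
  case (Pairing f x y g z)
  then show ?case by (metis computes_elims(6))
next
  case (Comp g x y f z)
  then show ?case by (metis computes_elims(7))
next
  case (Prec_0 f a y g)
  from Prec_0.prems show ?case
    by (rule computes_elims(8)) (auto intro: Prec_0.IH)
next
  case (Prec_Suc f g a n y z)
  from Prec_Suc.prems show ?case
    by (rule computes_elims(8)) (use Prec_Suc.IH in \<open>auto\<close>)
next
  case (Mu f a n)
  from Mu.prems obtain n0: "computes A f (prod_encode (a, z)) 0"
    and n1: "\<forall>m<z. \<exists>k. computes A f (prod_encode (a, m)) (Suc k)"
    by (rule computes_elims(9))
  have "\<not> z < n" using Mu.IH(2) n0 by blast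
  moreover have "\<not> n < z" using Mu.IH(1) n1 by blast
  ultimately show ?case by simp
qed (auto elim: computes_elims)

primrec code_number :: "code \<Rightarrow> nat" where
  "code_number Zero = 0"
| "code_number Succ = 1"
| "code_number Left = 2"
| "code_number Right = 3"
| "code_number Oracle = 4"
| "code_number (Pairing f g) = 4 * prod_encode (code_number f, code_number g) + 5"
| "code_number (Comp f g) = 4 * prod_encode (code_number f, code_number g) + 6"
| "code_number (Prec f g) = 4 * prod_encode (code_number f, code_number g) + 7"
| "code_number (Mu f) = 4 * code_number f + 8"

lemma bij_code_number: "bij code_number"
proof (rule bijI)
  have "code_number c = code_number d \<Longrightarrow> c = d" for c d
  proof (induction c arbitrary: d)
    case (Pairing f g)
    then show ?case by (cases d) (auto, presburger+)
  next
    case (Comp f g)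
    then show ?case by (cases d) (auto, presburger+)
  next
    case (Prec f g)
    then show ?case by (cases d) (auto, presburger+)
  next
    case (Mu f)
    then show ?case by (cases d) (auto, presburger+)
  qed (case_tac d; simp)+
  then show "inj code_number" by (rule injI)
next
  have "\<exists>c. code_number c = n" for n
  proof (induction n rule: less_induct)
    case (less n)
    show ?case
    proof (cases "n < 5")
      case True
      then have "n = 0 \<or> n = 1 \<or> n = 2 \<or> n = 3 \<or> n = 4" by linarith
      then show ?thesis using code_number.simps(1-5) by metis
    next
      case False
      define m where "m = (n - 5) div 4"
      obtain a b where ab: "m = prod_encode (a, b)"
        by (metis prod_decode_inverse surj_pair)
      have "a \<le> m" "b \<le> m" unfolding ab by (rule le_prod_encode_1, rule le_prod_encode_2)
      moreover have "m < n" using False by (auto simp: m_def)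
      ultimately have "a < n" "b < n" "m < n" by simp_all
      then obtain f g h where fgh: "code_number f = a" "code_number g = b" "code_number h = m"
        using less.IH by blast
      have "n = 4 * m + 5 \<or> n = 4 * m + 6 \<or> n = 4 * m + 7 \<or> n = 4 * m + 8"
        using False unfolding m_def by presburger
      then show ?thesis
        using fgh ab code_number.simps(6-9) by metis
    qed
  qed
  then show "surj code_number" by (metis surjI)
qed

definition turing_reducible :: "nat set \<Rightarrow> nat set \<Rightarrow> bool" (infix \<open>\<le>\<^sub>T\<close> 50) where
  "B \<le>\<^sub>T A \<longleftrightarrow> (\<exists>c. \<forall>n. computes A c n (if n \<in> B then 1 else 0))"

definition turing_equivalent :: "nat set \<Rightarrow> nat set \<Rightarrow> bool" (infix \<open>\<equiv>\<^sub>T\<close> 50) where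
  "A \<equiv>\<^sub>T B \<longleftrightarrow> A \<le>\<^sub>T B \<and> B \<le>\<^sub>T A"

definition ce_relative :: "nat set \<Rightarrow> nat set \<Rightarrow> bool" where
  "ce_relative A W \<longleftrightarrow> (\<exists>c. W = {n. \<exists>y. computes A c n y})"

abbreviation ce :: "nat set \<Rightarrow> bool" where
  "ce W \<equiv> ce_relative {} W"

definition turing_jump :: "nat set \<Rightarrow> nat set" where
  "turing_jump A = {code_number c | c. \<exists>y. computes A c (code_number c) y}"

definition low :: "nat set \<Rightarrow> bool" where
  "low A \<longleftrightarrow> turing_jump A \<equiv>\<^sub>T turing_jump {}"

section \<open>Weak 1-genericity\<close>

text \<open>
  Binary strings are identified with natural numbers by bijective base-2 numeration
  (least significant digit first), so that a set of strings can be c.e. relative to an oracle.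
\<close>

primrec string_number :: "bool list \<Rightarrow> nat" where
  "string_number [] = 0"
| "string_number (b # s) = 2 * string_number s + (if b then 2 else 1)"

lemma bij_string_number: "bij string_number"
proof (rule bijI)
  have "string_number s = string_number t \<Longrightarrow> s = t" for s t
  proof (induction s arbitrary: t)
    case Nil
    then show ?case by (cases t) (auto split: if_splits)
  next
    case (Cons b s)
    then show ?case by (cases t) (auto split: if_splits, presburger+)
  qed
  then show "inj string_number" by (rule injI)
next
  have "\<exists>s. string_number s = n" for n
  proof (induction n rule: less_induct)
    case (less n)
    show ?case
    proof (cases "n = 0")
      case True
      then show ?thesis using string_number.simps(1) by blast
    next
      case False
      then obtain s where s: "string_number s = (n - 1) div 2"
        using less.IH[of "(n - 1) div 2"] by fastforce
      have "string_number (even n # s) = n"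
        using False by (simp add: s) presburger
      then show ?thesis by blast
    qed
  qed
  then show "surj string_number" by (metis surjI)
qed

definition initial_segment :: "bool list \<Rightarrow> nat set \<Rightarrow> bool" where
  "initial_segment s X \<longleftrightarrow> s = map (\<lambda>i. i \<in> X) [0..<length s]"

definition dense_strings :: "bool list set \<Rightarrow> bool" where
  "dense_strings D \<longleftrightarrow> (\<forall>s. \<exists>t\<in>D. prefix s t)"

definition weakly_1_generic :: "nat set \<Rightarrow> nat set \<Rightarrow> bool" where
  "weakly_1_generic A G \<longleftrightarrow>
     (\<forall>D. dense_strings D \<and> ce_relative A (string_number ` D) \<longrightarrow>
       (\<exists>s\<in>D. initial_segment s G))"

section \<open>The space of coarse similarity classes\<close>

definition initial_density :: "nat \<Rightarrow> nat set \<Rightarrow> real" where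
  "initial_density n X = real (card (X \<inter> {0..<n})) / real n"

text \<open>The limit superior is formed in the extended reals; it is always a real number in \<open>[0, 1]\<close>.\<close>

definition upper_density :: "nat set \<Rightarrow> real" where
  "upper_density X = real_of_ereal (limsup (\<lambda>n. ereal (initial_density n X)))"

definition coarsely_similar :: "nat set \<Rightarrow> nat set \<Rightarrow> bool" where
  "coarsely_similar X Y \<longleftrightarrow> (\<lambda>n. initial_density n (sym_diff X Y)) \<longlonglongrightarrow> 0"

lemma initial_density_nonneg: "0 \<le> initial_density n X"
  by (simp add: initial_density_def)

lemma initial_density_le_1: "initial_density n X \<le> 1"
proof -
  have "card (X \<inter> {0..<n}) \<le> card {0..<n}" by (intro card_mono) auto
  then show ?thesis by (auto simp: initial_density_def divide_le_eq)
qed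

lemma initial_density_subadditive:
  assumes "X \<subseteq> Y \<union> Z"
  shows "initial_density n X \<le> initial_density n Y + initial_density n Z"
proof -
  have "card (X \<inter> {0..<n}) \<le> card (Y \<inter> {0..<n} \<union> Z \<inter> {0..<n})"
    using assms by (intro card_mono) auto
  also have "\<dots> \<le> card (Y \<inter> {0..<n}) + card (Z \<inter> {0..<n})" by (rule card_Un_le)
  finally have "real (card (X \<inter> {0..<n})) \<le> real (card (Y \<inter> {0..<n})) + real (card (Z \<inter> {0..<n}))"
    by linarith
  then show ?thesis
    unfolding initial_density_def add_divide_distrib[symmetric] by (rule divide_right_mono) simp
qed

lemma ereal_upper_density:
  "ereal (upper_density X) = limsup (\<lambda>n. ereal (initial_density n X))"
proof -
  let ?l = "limsup (\<lambda>n. ereal (initial_density n X))"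
  have "?l \<le> 1"
    by (rule Limsup_bounded) (simp add: initial_density_le_1)
  moreover have "0 \<le> ?l"
    by (rule le_Limsup) (simp_all add: initial_density_nonneg)
  ultimately have "\<bar>?l\<bar> \<noteq> \<infinity>" by auto
  then show ?thesis by (simp add: upper_density_def ereal_real')
qed

lemma upper_density_nonneg: "0 \<le> upper_density X"
proof -
  have "0 \<le> limsup (\<lambda>n. ereal (initial_density n X))"
    by (rule le_Limsup) (simp_all add: initial_density_nonneg)
  then show ?thesis by (simp add: upper_density_def real_of_ereal_pos)
qed

lemma upper_density_subadditive:
  assumes "X \<subseteq> Y \<union> Z"
  shows "upper_density X \<le> upper_density Y + upper_density Z"
proof -
  have "ereal (upper_density X) \<le>
      limsup (\<lambda>n. ereal (initial_density n Y) + ereal (initial_density n Z))"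
    unfolding ereal_upper_density using initial_density_subadditive[OF assms]
    by (intro Limsup_mono) simp
  also have "\<dots> \<le> ereal (upper_density Y) + ereal (upper_density Z)"
    unfolding ereal_upper_density by (rule ereal_limsup_add_mono)
  finally show ?thesis by simp
qed

lemma coarsely_similar_iff: "coarsely_similar X Y \<longleftrightarrow> upper_density (sym_diff X Y) = 0"
proof
  assume "coarsely_similar X Y"
  then have "(\<lambda>n. ereal (initial_density n (sym_diff X Y))) \<longlonglongrightarrow> ereal 0"
    unfolding coarsely_similar_def by simp
  then have "limsup (\<lambda>n. ereal (initial_density n (sym_diff X Y))) = ereal 0"
    by (intro lim_imp_Limsup) simp_all
  then show "upper_density (sym_diff X Y) = 0" by (simp add: upper_density_def)
next
  let ?f = "\<lambda>n. ereal (initial_density n (sym_diff X Y))"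
  assume "upper_density (sym_diff X Y) = 0"
  then have "limsup ?f = 0" using ereal_upper_density[of "sym_diff X Y"] by (simp add: zero_ereal_def)
  moreover have "0 \<le> liminf ?f"
    by (rule Liminf_bounded) (simp add: initial_density_nonneg)
  moreover have "liminf ?f \<le> limsup ?f" by (rule Liminf_le_Limsup) simp
  ultimately have "?f \<longlonglongrightarrow> ereal 0"
    by (intro Liminf_eq_Limsup) (simp_all add: antisym zero_ereal_def)
  then show "coarsely_similar X Y" unfolding coarsely_similar_def by simp
qed

lemma upper_density_sym_diff_triangle:
  "upper_density (sym_diff X Z) \<le> upper_density (sym_diff X Y) + upper_density (sym_diff Y Z)"
  by (rule upper_density_subadditive) blast

lemma sym_diff_commute: "sym_diff X Y = sym_diff Y X"
  by blast

lemma equivp_coarsely_similar: "equivp coarsely_similar"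
proof (rule equivpI)
  show "reflp coarsely_similar"
    by (rule reflpI) (simp add: coarsely_similar_def initial_density_def)
  show "symp coarsely_similar"
    by (rule sympI) (simp add: coarsely_similar_def Un_commute)
  show "transp coarsely_similar"
  proof (rule transpI)
    fix X Y Z
    assume "coarsely_similar X Y" "coarsely_similar Y Z"
    then show "coarsely_similar X Z"
      using upper_density_sym_diff_triangle[of X Z Y] upper_density_nonneg[of "sym_diff X Z"]
      by (simp add: coarsely_similar_iff)
  qed
qed

quotient_type coarse_class = "nat set" / coarsely_similar
  morphisms rep_coarse_class coarse_class
  by (rule equivp_coarsely_similar)

instantiation coarse_class :: metric_space
begin

lift_definition dist_coarse_class :: "coarse_class \<Rightarrow> coarse_class \<Rightarrow> real"
  is "\<lambda>X Y. upper_density (sym_diff X Y)"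
proof -
  have *: "upper_density (sym_diff X Y) \<le> upper_density (sym_diff X' Y')"
    if "coarsely_similar X' X" "coarsely_similar Y' Y" for X X' Y Y'
  proof -
    have "upper_density (sym_diff X Y) \<le> upper_density (sym_diff X X') + upper_density (sym_diff X' Y)"
      by (rule upper_density_sym_diff_triangle)
    also have "upper_density (sym_diff X' Y) \<le>
        upper_density (sym_diff X' Y') + upper_density (sym_diff Y' Y)"
      by (rule upper_density_sym_diff_triangle)
    finally show ?thesis
      using that by (simp add: coarsely_similar_iff sym_diff_commute[of X X'])
  qed
  fix X X' Y Y'
  assume "coarsely_similar X X'" "coarsely_similar Y Y'"
  then show "upper_density (sym_diff X Y) = upper_density (sym_diff X' Y')"
    using *[of X X' Y Y'] *[of X' X Y' Y] equivp_symp[OF equivp_coarsely_similar]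
    by (metis order_antisym)
qed

definition uniformity_coarse_class :: "(coarse_class \<times> coarse_class) filter" where
  "uniformity_coarse_class = (INF e\<in>{0<..}. principal {(x, y). dist x y < e})"

definition open_coarse_class :: "coarse_class set \<Rightarrow> bool" where
  "open_coarse_class U \<longleftrightarrow> (\<forall>x\<in>U. eventually (\<lambda>(x', y). x' = x \<longrightarrow> y \<in> U) uniformity)"

instance
proof
  fix x y z :: coarse_class
  show "dist x y = 0 \<longleftrightarrow> x = y"
    by transfer (simp add: coarsely_similar_iff)
  have "dist x y \<le> dist x z + dist z y" 
    by transfer (rule upper_density_sym_diff_triangle)
  moreover have "dist z y = dist y z"
    by transfer (simp add: Un_commute)
  ultimately show "dist x y \<le> dist x z + dist y z" by simp
qed (simp_all add: uniformity_coarse_class_def open_coarse_class_def)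

end

text \<open>The suprema are meaningful for nonempty bounded sets.\<close>

definition hausdorff_distance :: "'a::metric_space set \<Rightarrow> 'a set \<Rightarrow> real" where
  "hausdorff_distance S T = max (SUP x\<in>S. infdist x T) (SUP y\<in>T. infdist y S)"

definition computable_classes :: "nat set \<Rightarrow> coarse_class set" where
  "computable_classes A = {coarse_class X | X. X \<le>\<^sub>T A}"

definition coarse_distance :: "nat set \<Rightarrow> nat set \<Rightarrow> real" where
  "coarse_distance A B =
     hausdorff_distance (closure (computable_classes A)) (closure (computable_classes B))"

section \<open>Uniform measure and dispersive sets\<close>

text \<open>Points of Cantor space are characteristic functions; the set coded by \<open>x\<close> is \<open>Collect x\<close>.\<close>

definition cantor_measure :: "(nat \<Rightarrow> bool) measure" where
  "cantor_measure = PiM UNIV (\<lambda>_. measure_pmf (bernoulli_pmf (1 / 2)))"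

text \<open>
  Having measure 1 is expressed by \<^term>\<open>AE x in cantor_measure. P x\<close>, that is, the complement is
  contained in a measurable null set.
\<close>

definition dispersive :: "nat set \<Rightarrow> bool" where
  "dispersive A \<longleftrightarrow> \<not> (AE x in cantor_measure. coarse_distance A (Collect x) = 1 / 2)"

end

theory Submission
  imports Defs
begin

text \<open>
  A finite injury construction treats the requirement of meeting the \<open>e\<close>-th set of strings c.e. in \<open>A\<close>
  by \<open>2\<^sup>k\<close> strategies, \<open>k\<close> ranging over infinitely many levels. A strategy chooses a length \<open>n\<close> and waits
  for extensions of all strings of length \<open>n\<close> in that set; the next strategy of the level starts when
  it has been accepted. An oracle \<open>x\<close> follows, at each level \<open>k\<close>, only the strategy picked by \<open>k\<close> of
  its bits: it waits for it and then takes the extension provided. Only one strategy per level can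
  wait forever, so \<open>x\<close> is stuck at level \<open>k\<close> with probability at most \<open>2\<^sup>-\<^sup>k\<close>, and by the Borel-Cantelli
  lemma almost every \<open>x\<close> succeeds after ignoring finitely many levels. As \<open>x\<close> does not know \<open>A\<close>, the
  extensions are found with an approximation to the c.e. set \<open>A\<close>; Robinson's trick uses lowness to keep
  the number of acceptances based on false computations finite: before acceptance one asks \<open>A'\<close>, by a
  limit computation, whether the strategy ever proposes a true computation.

  A weakly 1-generic set relative to \<open>A\<close> disagrees with each set computable in \<open>A\<close> on almost all of
  infinitely many initial segments, which makes the Hausdorff distance at least \<open>1\<close>.
\<close>

section \<open>Closure properties of the total recursive functions\<close>

abbreviation pr :: "nat \<Rightarrow> nat \<Rightarrow> nat" where "pr x y \<equiv> prod_encode (x, y)"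
abbreviation lft :: "nat \<Rightarrow> nat" where "lft x \<equiv> fst (prod_decode x)"
abbreviation rgt :: "nat \<Rightarrow> nat" where "rgt x \<equiv> snd (prod_decode x)"

definition recursive :: "nat set \<Rightarrow> (nat \<Rightarrow> nat) \<Rightarrow> bool" where
  "recursive X f \<longleftrightarrow> (\<exists>c. \<forall>x. computes X c x (f x))"

abbreviation (input) decidable :: "nat set \<Rightarrow> (nat \<Rightarrow> bool) \<Rightarrow> bool" where
  "decidable X P \<equiv> recursive X (\<lambda>x. of_bool (P x))"

named_theorems rec_intros

lemma recursiveI: "(\<And>x. computes X c x (f x)) \<Longrightarrow> recursive X f"
  unfolding recursive_def by blast

lemma rec_comp:
  assumes "recursive X f" and "recursive X g"
  shows "recursive X (\<lambda>x. f (g x))"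
  using assms unfolding recursive_def by (metis computes.Comp)

lemma rec_id [rec_intros]: "recursive X (\<lambda>x. x)"
proof (rule recursiveI)
  show "computes X (Pairing Left Right) x x" for x
    by (metis computes.Pairing computes.Left computes.Right prod.collapse prod_decode_inverse)
qed

lemma rec_const [rec_intros]: "recursive X (\<lambda>x. k)"
proof (induction k)
  case 0
  show ?case by (rule recursiveI) (rule computes.Zero)
next
  case (Suc k)
  have "recursive X Suc" by (rule recursiveI) (rule computes.Succ)
  from rec_comp[OF this Suc] show ?case .
qed

lemma rec_Suc [rec_intros]: "recursive X f \<Longrightarrow> recursive X (\<lambda>x. Suc (f x))"
  by (rule rec_comp[of X Suc]) (rule recursiveI, rule computes.Succ)

lemma rec_lft [rec_intros]: "recursive X f \<Longrightarrow> recursive X (\<lambda>x. lft (f x))"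
  by (rule rec_comp[of X lft]) (rule recursiveI, rule computes.Left)

lemma rec_rgt [rec_intros]: "recursive X f \<Longrightarrow> recursive X (\<lambda>x. rgt (f x))"
  by (rule rec_comp[of X rgt]) (rule recursiveI, rule computes.Right)

lemma rec_pr [rec_intros]:
  "recursive X f \<Longrightarrow> recursive X g \<Longrightarrow> recursive X (\<lambda>x. pr (f x) (g x))"
  unfolding recursive_def by (metis computes.Pairing)

lemma dec_oracle: "recursive X f \<Longrightarrow> decidable X (\<lambda>x. f x \<in> X)"
  unfolding of_bool_def
  by (rule rec_comp[of X "\<lambda>x. if x \<in> X then 1 else 0"], rule recursiveI) (rule computes.Oracle)

lemma rec_primrec [rec_intros]:
  assumes f: "recursive X f" and g: "recursive X (\<lambda>z. g (lft z) (lft (rgt z)) (rgt (rgt z)))"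
    and h: "recursive X h"
  shows "recursive X (\<lambda>x. rec_nat (f x) (\<lambda>n y. g x n y) (h x))"
proof -
  obtain c d where c: "\<And>x. computes X c x (f x)"
    and d: "\<And>z. computes X d z (g (lft z) (lft (rgt z)) (rgt (rgt z)))"
    using f g unfolding recursive_def by blast
  have "computes X (Prec c d) (pr a n) (rec_nat (f a) (\<lambda>n y. g a n y) n)" for a n
  proof (induction n)
    case 0
    show ?case using computes.Prec_0[OF c] by simp
  next
    case (Suc n)
    have "computes X d (pr a (pr n (rec_nat (f a) (\<lambda>n y. g a n y) n)))
        (g a n (rec_nat (f a) (\<lambda>n y. g a n y) n))"
      using d[of "pr a (pr n (rec_nat (f a) (\<lambda>n y. g a n y) n))"] by simp
    from computes.Prec_Suc[OF Suc this] show ?case by simp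
  qed
  from this[of "lft z" "rgt z" for z]
  have "recursive X (\<lambda>z. rec_nat (f (lft z)) (\<lambda>n y. g (lft z) n y) (rgt z))"
    by (intro recursiveI[where c = "Prec c d"]) simp
  from rec_comp[OF this rec_pr[OF rec_id h]] show ?thesis by simp
qed

lemma rec_add [rec_intros]:
  assumes "recursive X f" "recursive X g" shows "recursive X (\<lambda>x. f x + g x)"
proof -
  have "recursive X (\<lambda>x. rec_nat (f x) (\<lambda>_ y. Suc y) (g x))"
    by (intro rec_intros assms)
  moreover have "rec_nat a (\<lambda>_ y. Suc y) b = a + b" for a b by (induction b) auto
  ultimately show ?thesis by simp
qed

lemma rec_diff [rec_intros]:
  assumes "recursive X f" "recursive X g" shows "recursive X (\<lambda>x. f x - g x)"
proof -
  \<comment> \<open>The inner recursion is the predecessor: its step returns the counter and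
    discards the previous value.\<close>
  have "recursive X (\<lambda>x. rec_nat (f x) (\<lambda>_ y. rec_nat 0 (\<lambda>n _. n) y) (g x))"
    by (intro rec_intros assms)
  moreover have "rec_nat 0 (\<lambda>n _. n) y = y - 1" for y by (cases y) auto
  moreover have "rec_nat a (\<lambda>_ y. y - 1) b = a - b" for a b :: nat by (induction b) auto
  ultimately show ?thesis by simp
qed

lemma rec_mult [rec_intros]:
  assumes "recursive X f" "recursive X g" shows "recursive X (\<lambda>x. f x * g x)"
proof -
  have "recursive X (\<lambda>x. rec_nat 0 (\<lambda>_ y. f x + y) (g x))"
    by (intro rec_intros assms rec_comp[OF assms(1)])
  moreover have "rec_nat 0 (\<lambda>_ y. a + y) b = a * b" for a b :: nat by (induction b) auto
  ultimately show ?thesis by simp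
qed

lemma rec_power [rec_intros]:
  assumes "recursive X f" "recursive X g" shows "recursive X (\<lambda>x. f x ^ g x)"
proof -
  have "recursive X (\<lambda>x. rec_nat 1 (\<lambda>_ y. f x * y) (g x))"
    by (intro rec_intros assms rec_comp[OF assms(1)])
  moreover have "rec_nat 1 (\<lambda>_ y. a * y) b = a ^ b" for a b :: nat by (induction b) auto
  ultimately show ?thesis by simp
qed

lemma dec_le [rec_intros]:
  assumes "recursive X f" "recursive X g" shows "decidable X (\<lambda>x. f x \<le> g x)"
proof -
  have "recursive X (\<lambda>x. 1 - (f x - g x))" by (intro rec_intros assms)
  moreover have "(\<lambda>x. 1 - (f x - g x)) = (\<lambda>x. of_bool (f x \<le> g x))" by (auto simp: of_bool_def)
  ultimately show ?thesis by simp
qed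

lemma dec_less [rec_intros]:
  assumes "recursive X f" "recursive X g" shows "decidable X (\<lambda>x. f x < g x)"
  using dec_le[OF rec_Suc[OF assms(1)] assms(2)] by (simp add: Suc_le_eq)

lemma dec_not [rec_intros]:
  assumes "decidable X P" shows "decidable X (\<lambda>x. \<not> P x)"
proof -
  have "(\<lambda>x. of_bool (\<not> P x)) = (\<lambda>x. 1 - of_bool (P x) :: nat)" by auto
  then show ?thesis using rec_diff[OF rec_const[of X 1] assms] by simp
qed

lemma dec_conj [rec_intros]:
  assumes "decidable X P" "decidable X Q" shows "decidable X (\<lambda>x. P x \<and> Q x)"
  using rec_mult[OF assms] by (simp add: of_bool_conj)

lemma dec_disj [rec_intros]:
  assumes "decidable X P" "decidable X Q" shows "decidable X (\<lambda>x. P x \<or> Q x)"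
  using dec_not[OF dec_conj[OF dec_not[OF assms(1)] dec_not[OF assms(2)]]] by simp

lemma dec_imp [rec_intros]:
  assumes "decidable X P" "decidable X Q" shows "decidable X (\<lambda>x. P x \<longrightarrow> Q x)"
  using dec_disj[OF dec_not[OF assms(1)] assms(2)] by (simp only: imp_conv_disj)

lemma dec_iff [rec_intros]:
  assumes "decidable X P" "decidable X Q" shows "decidable X (\<lambda>x. P x \<longleftrightarrow> Q x)"
  using dec_conj[OF dec_imp[OF assms] dec_imp[OF assms(2,1)]]
  by (simp only: iff_conv_conj_imp)

lemma dec_eq [rec_intros]:
  fixes f g :: "nat \<Rightarrow> nat"
  assumes "recursive X f" "recursive X g" shows "decidable X (\<lambda>x. f x = g x)"
  using dec_conj[OF dec_le[OF assms] dec_le[OF assms(2,1)]] unfolding eq_iff .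

lemma rec_if [rec_intros]:
  assumes "decidable X P" "recursive X f" "recursive X g"
  shows "recursive X (\<lambda>x. if P x then f x else g x)"
proof -
  have "recursive X (\<lambda>x. of_bool (P x) * f x + of_bool (\<not> P x) * g x)"
    by (intro rec_intros assms)
  moreover have "(\<lambda>x. of_bool (P x) * f x + of_bool (\<not> P x) * g x) = (\<lambda>x. if P x then f x else g x)"
    by auto
  ultimately show ?thesis by simp
qed

lemma dec_ex_less [rec_intros]:
  assumes "recursive X h" "decidable X (\<lambda>z. P (lft z) (rgt z))"
  shows "decidable X (\<lambda>x. \<exists>i<h x. P x i)"
proof -
  have 1: "decidable X (\<lambda>z. P (lft z) (lft (rgt z)))"
    by (rule rec_comp[OF assms(2), of "\<lambda>z. pr (lft z) (lft (rgt z))", simplified]) (intro rec_intros)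
  have "recursive X (\<lambda>x. rec_nat 0 (\<lambda>i y. of_bool (0 < y \<or> P x i)) (h x))"
    by (intro rec_intros assms 1)
  moreover have "rec_nat 0 (\<lambda>i y. of_bool (0 < y \<or> P x i)) n = (of_bool (\<exists>i<n. P x i) :: nat)" for x n
    by (induction n) (auto simp: less_Suc_eq)
  ultimately show ?thesis by simp
qed

lemma dec_all_less [rec_intros]:
  assumes "recursive X h" "decidable X (\<lambda>z. P (lft z) (rgt z))"
  shows "decidable X (\<lambda>x. \<forall>i<h x. P x i)"
  using dec_not[OF dec_ex_less[OF assms(1) dec_not[OF assms(2)]]] by simp

lemma dec_ex_le [rec_intros]:
  assumes "recursive X h" "decidable X (\<lambda>z. P (lft z) (rgt z))"
  shows "decidable X (\<lambda>x. \<exists>i\<le>h x. P x i)"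
  using dec_ex_less[OF rec_Suc[OF assms(1)] assms(2)] by (simp add: less_Suc_eq_le)

text \<open>\<open>Mu\<close> looks for the value 0, so \<open>c\<close> decides the negation of
  \<open>P\<close>; since \<open>c\<close> is total, the clause about smaller arguments reduces to
  the failure of \<open>P\<close> there.\<close>

lemma computes_Mu_iff:
  assumes "\<And>x. computes X c x (of_bool (\<not> P (lft x) (rgt x)))"
  shows "computes X (Mu c) x n \<longleftrightarrow> P x n \<and> (\<forall>m<n. \<not> P x m)"
proof -
  have *: "computes X c (pr a m) k \<longleftrightarrow> k = of_bool (\<not> P a m)" for a m k
    using computes_deterministic[OF _ assms, of "pr a m" k] assms[of "pr a m"]
    by (metis fst_conv snd_conv prod_encode_inverse)
  have "computes X (Mu c) x n \<longleftrightarrow>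
      computes X c (pr x n) 0 \<and> (\<forall>m<n. \<exists>k. computes X c (pr x m) (Suc k))"
    by (rule iffI, erule computes_elims(9), blast) (rule computes.Mu, blast+)
  also have "\<dots> \<longleftrightarrow> P x n \<and> (\<forall>m<n. \<not> P x m)"
    unfolding * by (auto simp: of_bool_def)
  finally show ?thesis .
qed

lemma rec_Least [rec_intros]:
  assumes "decidable X (\<lambda>z. P (lft z) (rgt z))" and ex: "\<And>x. \<exists>n. P x n"
  shows "recursive X (\<lambda>x. LEAST n. P x n)"
proof -
  obtain c where "\<And>x. computes X c x (of_bool (\<not> P (lft x) (rgt x)))"
    using dec_not[OF assms(1)] unfolding recursive_def by blast
  note iff = computes_Mu_iff[of X c P, OF this]
  show ?thesis
  proof (rule recursiveI)
    show "computes X (Mu c) x (LEAST n. P x n)" for x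
      unfolding iff using LeastI_ex[OF ex[of x]] not_less_Least[of _ "P x"] by blast
  qed
qed

text \<open>Existential projections of decidable relations are c.e.: unbounded search halts exactly
  when there is a witness.\<close>

lemma ex_domain_code:
  assumes "decidable X (\<lambda>z. P (lft z) (rgt z))"
  obtains c where "\<And>x. (\<exists>y. computes X c x y) \<longleftrightarrow> (\<exists>n. P x n)"
proof -
  obtain c where "\<And>x. computes X c x (of_bool (\<not> P (lft x) (rgt x)))"
    using dec_not[OF assms] unfolding recursive_def by blast
  note iff = computes_Mu_iff[of X c P, OF this]
  have "(\<exists>y. computes X (Mu c) x y) \<longleftrightarrow> (\<exists>n. P x n)" for x
    unfolding iff using exists_least_iff[of "P x"] by blast
  then show ?thesis using that by blast
qed

lemma turing_reducible_iff: "B \<le>\<^sub>T X \<longleftrightarrow> decidable X (\<lambda>n. n \<in> B)"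
  unfolding turing_reducible_def recursive_def of_bool_def ..

subsection \<open>Lists\<close>

abbreviation (input) lrecursive :: "nat set \<Rightarrow> (nat \<Rightarrow> nat list) \<Rightarrow> bool" where
  "lrecursive X l \<equiv> recursive X (\<lambda>x. list_encode (l x))"

text \<open>The default 0 makes access total. In a state of the construction it reads as a strategy
  that is still waiting.\<close>

definition entry :: "nat list \<Rightarrow> nat \<Rightarrow> nat" where
  "entry l i = (if i < length l then l ! i else 0)"

text \<open>A nonempty list has the code \<open>Suc (pr x y)\<close>; the empty list is covered
  because \<open>0 - 1 = 0\<close> and 0 decodes to \<open>(0, 0)\<close>.\<close>

lemma list_encode_tl: "list_encode (tl l) = rgt (list_encode l - 1)"
proof (cases l)
  case Nil
  have "prod_decode 0 = (0, 0)" by (simp add: prod_decode_def prod_decode_aux.simps)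
  then show ?thesis using Nil by simp
qed simp

lemma entry_0: "entry l 0 = lft (list_encode l - 1)"
proof (cases l)
  case Nil
  have "prod_decode 0 = (0, 0)" by (simp add: prod_decode_def prod_decode_aux.simps)
  then show ?thesis using Nil by (simp add: entry_def)
qed (simp add: entry_def)

lemma lrec_decode [rec_intros]: "recursive X f \<Longrightarrow> lrecursive X (\<lambda>x. list_decode (f x))"
  by simp

lemma lrec_Cons [rec_intros]:
  "recursive X f \<Longrightarrow> lrecursive X l \<Longrightarrow> lrecursive X (\<lambda>x. f x # l x)"
  unfolding list_encode.simps by (intro rec_intros)

lemma lrec_drop [rec_intros]:
  assumes "recursive X n" "lrecursive X l"
  shows "lrecursive X (\<lambda>x. drop (n x) (l x))"
proof -
  have "recursive X (\<lambda>x. rec_nat (list_encode (l x)) (\<lambda>_ y. rgt (y - 1)) (n x))"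
    by (intro rec_intros assms)
  moreover have "rec_nat (list_encode a) (\<lambda>_ y. rgt (y - 1)) k = list_encode (drop k a)" for a k
    by (induction k) (simp_all add: drop_Suc tl_drop[symmetric] list_encode_tl del: One_nat_def)
  ultimately show ?thesis by simp
qed

lemma list_encode_eq_0 [simp]: "list_encode l = 0 \<longleftrightarrow> l = []"
  by (cases l) auto

lemma rec_length [rec_intros]:
  assumes "lrecursive X l" shows "recursive X (\<lambda>x. length (l x))"
proof -
  have 1: "recursive X (\<lambda>z. list_encode (l (lft z)))"
    by (rule rec_comp[OF assms]) (intro rec_intros)
  have "recursive X (\<lambda>x. LEAST n. list_encode (drop n (l x)) = 0)"
    by (intro rec_intros 1) (auto intro: exI[of _ "length (l x)" for x])
  moreover have "(LEAST n. list_encode (drop n a) = 0) = length a" for a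
    by (rule Least_equality) auto
  ultimately show ?thesis by simp
qed

lemma rec_entry [rec_intros]:
  assumes "lrecursive X l" "recursive X n"
  shows "recursive X (\<lambda>x. entry (l x) (n x))"
proof -
  have "recursive X (\<lambda>x. lft (list_encode (drop (n x) (l x)) - 1))"
    by (intro rec_intros assms)
  moreover have "lft (list_encode (drop k a) - 1) = entry a k" for a k
    unfolding entry_0[symmetric] by (auto simp: entry_def hd_drop_conv_nth)
  ultimately show ?thesis by simp
qed

lemma less_list_encode: "z \<in> set l \<Longrightarrow> z < list_encode l"
proof (induction l)
  case (Cons a l)
  then show ?case
    using le_prod_encode_1[of a "list_encode l"] le_prod_encode_2[of "list_encode l" a] by auto
qed simp

lemma dec_mem [rec_intros]:
  assumes "recursive X f" "lrecursive X l"
  shows "decidable X (\<lambda>x. f x \<in> set (l x))"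
proof -
  have 1: "lrecursive X (\<lambda>z. l (lft z))" "recursive X (\<lambda>z. f (lft z))"
    by (rule rec_comp[OF assms(2)] rec_comp[OF assms(1)], intro rec_intros)+
  have "decidable X (\<lambda>x. \<exists>i<length (l x). entry (l x) i = f x)"
    by (intro rec_intros 1 assms)
  moreover have "(\<exists>i<length a. entry a i = k) \<longleftrightarrow> k \<in> set a" for a k
    by (auto simp: entry_def in_set_conv_nth)
  ultimately show ?thesis by simp
qed

text \<open>Lists that grow at their end are coded in reverse order.\<close>

abbreviation (input) rrecursive :: "nat set \<Rightarrow> (nat \<Rightarrow> nat list) \<Rightarrow> bool" where
  "rrecursive X l \<equiv> lrecursive X (\<lambda>x. rev (l x))"

lemma rrec_decode [rec_intros]: "recursive X f \<Longrightarrow> rrecursive X (\<lambda>x. rev (list_decode (f x)))"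
  by simp

lemma rrec_Nil [rec_intros]: "rrecursive X (\<lambda>x. [])"
  by (simp add: rec_const)

lemma rrec_snoc [rec_intros]:
  assumes "recursive X f" "rrecursive X l" shows "rrecursive X (\<lambda>x. l x @ [f x])"
  using lrec_Cons[OF assms] by simp

lemma rrec_length:
  assumes "rrecursive X l" shows "recursive X (\<lambda>x. length (l x))"
  using rec_length[OF assms] by simp

lemma rrec_take [rec_intros]:
  assumes "recursive X n" "rrecursive X l" shows "rrecursive X (\<lambda>x. take (n x) (l x))"
proof -
  have "lrecursive X (\<lambda>x. drop (length (l x) - n x) (rev (l x)))"
    by (intro lrec_drop rec_diff rrec_length assms)
  then show ?thesis by (simp only: rev_take)
qed

lemma rrec_entry:
  assumes "rrecursive X l" "recursive X n"
  shows "recursive X (\<lambda>x. entry (l x) (n x))"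
proof -
  have "recursive X (\<lambda>x. if n x < length (l x) then entry (rev (l x)) (length (l x) - Suc (n x)) else 0)"
    by (intro rec_if dec_less rec_entry rec_diff rec_Suc rrec_length rec_const assms)
  moreover have "(if k < length a then entry (rev a) (length a - Suc k) else 0) = entry a k" for a k
    by (auto simp: entry_def rev_nth)
  ultimately show ?thesis by simp
qed

lemma rrec_if [rec_intros]:
  assumes "decidable X P" "rrecursive X f" "rrecursive X g"
  shows "rrecursive X (\<lambda>x. if P x then f x else g x)"
  using rec_if[OF assms] by (simp add: if_distrib)

lemma rrec_primrec:
  assumes "rrecursive X f" "rrecursive X (\<lambda>z. g (lft z) (lft (rgt z)) (rev (list_decode (rgt (rgt z)))))"
    and "recursive X h"
  shows "rrecursive X (\<lambda>x. rec_nat (f x) (\<lambda>n y. g x n y) (h x))"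
proof -
  have "recursive X (\<lambda>x. rec_nat (list_encode (rev (f x)))
      (\<lambda>n y. list_encode (rev (g x n (rev (list_decode y))))) (h x))"
    by (intro rec_intros assms)
  moreover have "rec_nat (list_encode (rev a)) (\<lambda>n y. list_encode (rev (g x n (rev (list_decode y))))) k
      = list_encode (rev (rec_nat a (\<lambda>n y. g x n y) k))" for a k x
    by (induction k) auto
  ultimately show ?thesis by simp
qed

section \<open>Derivations as witnesses of computations\<close>

abbreviation tr :: "nat \<Rightarrow> nat \<Rightarrow> nat \<Rightarrow> nat" where "tr c x y \<equiv> pr c (pr x y)"

text \<open>\<open>S\<close> holds the lines already derived, and each disjunct is a rule of
  \<open>computes\<close> read on program numbers. The bounds on \<open>f\<close> and
  \<open>g\<close> are harmless, as a program has a larger number than its parts, and they make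
  these quantifiers decidable.\<close>

definition justified :: "nat set \<Rightarrow> nat set \<Rightarrow> nat \<Rightarrow> nat \<Rightarrow> nat \<Rightarrow> bool" where
  "justified X S c x y \<longleftrightarrow>
     c = 0 \<and> y = 0 \<or> c = 1 \<and> y = Suc x \<or> c = 2 \<and> y = lft x \<or> c = 3 \<and> y = rgt x \<or>
     c = 4 \<and> y = of_bool (x \<in> X) \<or>
     (\<exists>f<c. \<exists>g<c. c = 4 * pr f g + 5 \<and> tr f x (lft y) \<in> S \<and> tr g x (rgt y) \<in> S) \<or>
     (\<exists>f<c. \<exists>g<c. c = 4 * pr f g + 6 \<and> (\<exists>m. tr g x m \<in> S \<and> tr f m y \<in> S)) \<or>
     (\<exists>f<c. \<exists>g<c. c = 4 * pr f g + 7 \<and>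
        (rgt x = 0 \<and> tr f (lft x) y \<in> S \<or>
         (\<exists>n<rgt x. rgt x = Suc n \<and>
            (\<exists>m. tr c (pr (lft x) n) m \<in> S \<and> tr g (pr (lft x) (pr n m)) y \<in> S)))) \<or>
     (\<exists>f<c. c = 4 * f + 8 \<and> tr f (pr x y) 0 \<in> S \<and> (\<forall>m<y. \<exists>k. tr f (pr x m) (Suc k) \<in> S))"

text \<open>The newest line is the head, so that each line may appeal to the tail only.\<close>

primrec derivation :: "nat set \<Rightarrow> nat list \<Rightarrow> bool" where
  "derivation X [] = True"
| "derivation X (z # l) =
     (justified X (set l) (lft z) (lft (rgt z)) (rgt (rgt z)) \<and> derivation X l)"

text \<open>Kleene's T-predicate; the witness \<open>w\<close> also bounds all oracle queries.\<close>

definition T :: "nat set \<Rightarrow> nat \<Rightarrow> nat \<Rightarrow> nat \<Rightarrow> nat \<Rightarrow> bool" where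
  "T X w c x y \<longleftrightarrow> derivation X (list_decode w) \<and> tr c x y \<in> set (list_decode w)"

lemma justified_mono:
  assumes "justified X S c x y" and S: "S \<subseteq> S'"
  shows "justified X S' c x y"
  using assms(1) unfolding justified_def
  by (elim disj_forward ex_forward conj_forward) (use S in blast)+

lemma derivation_append: "derivation X k \<Longrightarrow> derivation X l \<Longrightarrow> derivation X (k @ l)"
  by (induction k) (auto intro: justified_mono)

lemma code_number_eq_iff: "code_number c = code_number d \<longleftrightarrow> c = d"
  using bij_code_number by (auto simp: bij_def inj_def)

lemma ex_code_number: "\<exists>c. n = code_number c"
  using bij_code_number by (auto simp: bij_def surj_def)

lemma justified_imp_computes:
  assumes "justified X S (code_number c) x y"
    and S: "\<And>d u v. tr (code_number d) u v \<in> S \<Longrightarrow> computes X d u v"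
  shows "computes X c x y"
proof -
  note cn = code_number.simps[symmetric] code_number_eq_iff
  note cn' = code_number.simps(6-9)[symmetric] code_number_eq_iff
  from assms(1)[unfolded justified_def] show ?thesis
  proof (elim disjE exE conjE)
    assume "code_number c = 0" "y = 0"
    then show ?thesis by (metis cn computes.Zero)
  next
    assume "code_number c = 1" "y = Suc x"
    then show ?thesis by (metis cn computes.Succ)
  next
    assume "code_number c = 2" "y = lft x"
    then show ?thesis by (metis cn computes.Left)
  next
    assume "code_number c = 3" "y = rgt x"
    then show ?thesis by (metis cn computes.Right)
  next
    assume "code_number c = 4" "y = of_bool (x \<in> X)"
    then have "c = Oracle" by (metis cn)
    then show ?thesis using computes.Oracle \<open>y = of_bool (x \<in> X)\<close> unfolding of_bool_def by blast
  next
    fix f g assume c: "code_number c = 4 * pr f g + 5" and *: "tr f x (lft y) \<in> S" "tr g x (rgt y) \<in> S"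
    obtain f' g' where fg: "f = code_number f'" "g = code_number g'" using ex_code_number by metis
    have "c = Pairing f' g'" using c unfolding fg by (simp only: cn')
    then show ?thesis using computes.Pairing[OF S S, OF *[unfolded fg]] by simp
  next
    fix f g m assume c: "code_number c = 4 * pr f g + 6" and *: "tr g x m \<in> S" "tr f m y \<in> S"
    obtain f' g' where fg: "f = code_number f'" "g = code_number g'" using ex_code_number by metis
    have "c = Comp f' g'" using c unfolding fg by (simp only: cn')
    then show ?thesis using computes.Comp[OF S S, OF *[unfolded fg]] by simp
  next
    fix f g assume c: "code_number c = 4 * pr f g + 7" and *: "rgt x = 0" "tr f (lft x) y \<in> S"
    obtain f' g' where fg: "f = code_number f'" "g = code_number g'" using ex_code_number by metis
    have "c = Prec f' g'" using c unfolding fg by (simp only: cn')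
    moreover have "x = pr (lft x) 0" using *(1) by (metis prod.collapse prod_decode_inverse)
    ultimately show ?thesis using computes.Prec_0[OF S, OF *(2)[unfolded fg]] by simp
  next
    fix f g n m assume c: "code_number c = 4 * pr f g + 7" and *: "rgt x = Suc n"
      "tr (code_number c) (pr (lft x) n) m \<in> S" "tr g (pr (lft x) (pr n m)) y \<in> S"
    obtain f' g' where fg: "f = code_number f'" "g = code_number g'" using ex_code_number by metis
    have c': "c = Prec f' g'" using c unfolding fg by (simp only: cn')
    moreover have "x = pr (lft x) (Suc n)" using *(1) by (metis prod.collapse prod_decode_inverse)
    ultimately show ?thesis
      using computes.Prec_Suc[OF S[OF *(2), unfolded c'] S[OF *(3)[unfolded fg]]] by simp
  next
    fix f assume c: "code_number c = 4 * f + 8" and *: "tr f (pr x y) 0 \<in> S"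
      "\<forall>m<y. \<exists>k. tr f (pr x m) (Suc k) \<in> S"
    obtain f' where fg: "f = code_number f'" using ex_code_number by metis
    have c': "c = Mu f'" using c unfolding fg by (simp only: cn')
    then show ?thesis using S * unfolding fg by (metis computes.Mu)
  qed
qed

lemma derivation_imp_computes:
  "derivation X l \<Longrightarrow> tr (code_number c) x y \<in> set l \<Longrightarrow> computes X c x y"
proof (induction l arbitrary: c x y)
  case (Cons z l)
  show ?case
  proof (cases "tr (code_number c) x y \<in> set l")
    case True
    then show ?thesis using Cons by simp
  next
    case False
    then have "z = tr (code_number c) x y" using Cons.prems by simp
    then have "justified X (set l) (code_number c) x y" using Cons.prems by simp
    then show ?thesis by (rule justified_imp_computes) (use Cons in auto)
  qed
qed simp

lemma computes_imp_derivation: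
  "computes X c x y \<Longrightarrow> \<exists>l. derivation X l \<and> tr (code_number c) x y \<in> set l"
proof (induction rule: computes.induct)
  have step: "\<exists>l. derivation X l \<and> tr c x y \<in> set l"
    if "derivation X l" "justified X (set l) c x y" for c x y l
    using that by (intro exI[of _ "tr c x y # l"]) auto
  note less = le_prod_encode_1 le_prod_encode_2
  {
    case (Zero x)
    show ?case by (rule step[of "[]"]) (auto simp: justified_def)
  next
    case (Succ x)
    show ?case by (rule step[of "[]"]) (auto simp: justified_def)
  next
    case (Left x)
    show ?case by (rule step[of "[]"]) (auto simp: justified_def)
  next
    case (Right x)
    show ?case by (rule step[of "[]"]) (auto simp: justified_def)
  next
    case (Oracle x)
    show ?case by (rule step[of "[]"]) (auto simp: justified_def)
  next
    case (Pairing f x y g z)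
    then obtain k l where k: "derivation X k" "tr (code_number f) x y \<in> set k"
      and l: "derivation X l" "tr (code_number g) x z \<in> set l" by blast
    have "code_number f < code_number (Pairing f g)" "code_number g < code_number (Pairing f g)"
      using less[of "code_number f" "code_number g"] less[of "code_number g" "code_number f"] by simp_all
    then show ?case using k l
      by (intro step[OF derivation_append[OF k(1) l(1)]]) (auto simp: justified_def)
  next
    case (Comp g x y f z)
    then obtain k l where k: "derivation X k" "tr (code_number g) x y \<in> set k"
      and l: "derivation X l" "tr (code_number f) y z \<in> set l" by blast
    have "code_number f < code_number (Comp f g)" "code_number g < code_number (Comp f g)"
      using less[of "code_number f" "code_number g"] less[of "code_number g" "code_number f"] by simp_all
    then show ?case using k l
      by (intro step[OF derivation_append[OF k(1) l(1)]]) (auto simp: justified_def)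
  next
    case (Prec_0 f a y g)
    then obtain k where k: "derivation X k" "tr (code_number f) a y \<in> set k" by blast
    have "code_number f < code_number (Prec f g)" "code_number g < code_number (Prec f g)"
      using less[of "code_number f" "code_number g"] less[of "code_number g" "code_number f"] by simp_all
    then show ?case using k by (intro step[OF k(1)]) (auto simp: justified_def)
  next
    case (Prec_Suc f g a n y z)
    then obtain k l where k: "derivation X k" "tr (code_number (Prec f g)) (pr a n) y \<in> set k"
      and l: "derivation X l" "tr (code_number g) (pr a (pr n y)) z \<in> set l" by blast
    have "code_number f < code_number (Prec f g)" "code_number g < code_number (Prec f g)"
      using less[of "code_number f" "code_number g"] less[of "code_number g" "code_number f"] by simp_all
    then show ?case using k l
      by (intro step[OF derivation_append[OF k(1) l(1)]]) (auto simp: justified_def)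
  next
    case (Mu f a n)
    then obtain k where k: "derivation X k" "tr (code_number f) (pr a n) 0 \<in> set k" by blast
    \<comment> \<open>\<open>Mu\<close> has one premise for each \<open>m < n\<close>; their
      derivations are concatenated by induction.\<close>
    have "\<exists>l. derivation X l \<and> (\<forall>m<j. \<exists>i. tr (code_number f) (pr a m) (Suc i) \<in> set l)" if "j \<le> n" for j
      using that
    proof (induction j)
      case 0
      then show ?case by (intro exI[of _ "[]"]) simp
    next
      case (Suc j)
      then obtain l where l: "derivation X l"
        "\<forall>m<j. \<exists>i. tr (code_number f) (pr a m) (Suc i) \<in> set l" by auto
      obtain i l' where l': "derivation X l'" "tr (code_number f) (pr a j) (Suc i) \<in> set l'"
        using Mu.IH(2) Suc.prems by (meson Suc_le_lessD)
      show ?case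
        using l l' by (intro exI[of _ "l @ l'"]) (auto intro: derivation_append simp: less_Suc_eq)
    qed
    then obtain l where l: "derivation X l"
      "\<forall>m<n. \<exists>i. tr (code_number f) (pr a m) (Suc i) \<in> set l" by blast
    show ?case using k l
      by (intro step[OF derivation_append[OF k(1) l(1)]]) (auto simp: justified_def)
  }
qed

lemma computes_iff_T: "computes X c x y \<longleftrightarrow> (\<exists>w. T X w (code_number c) x y)"
  unfolding T_def
  by (metis computes_imp_derivation derivation_imp_computes list_encode_inverse)

lemma tr_mem_bounds:
  assumes "tr c x y \<in> set (list_decode w)" shows "c < w" "x < w" "y < w"
proof -
  have "tr c x y < w" using less_list_encode[OF assms] by simp
  then show "c < w" "x < w" "y < w"
    using le_prod_encode_1[of c "pr x y"] le_prod_encode_2[of "pr x y" c]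
      le_prod_encode_1[of x y] le_prod_encode_2[of y x] by linarith+
qed

lemma justified_cong:
  "(x \<in> X \<longleftrightarrow> x \<in> Z) \<Longrightarrow> justified X S c x y = justified Z S c x y"
  unfolding justified_def by simp

lemma derivation_cong:
  assumes "\<And>i. i < w \<Longrightarrow> i \<in> X \<longleftrightarrow> i \<in> Z" and "list_encode l \<le> w"
  shows "derivation X l = derivation Z l"
  using assms(2)
proof (induction l)
  case (Cons z l)
  have "lft (rgt z) < list_encode (z # l)"
    using tr_mem_bounds(2)[of "lft z" "lft (rgt z)" "rgt (rgt z)" "list_encode (z # l)"]
    by (simp del: list_encode.simps)
  then have "justified X (set l) (lft z) (lft (rgt z)) (rgt (rgt z)) =
      justified Z (set l) (lft z) (lft (rgt z)) (rgt (rgt z))"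
    using Cons.prems by (intro justified_cong assms(1)) linarith
  moreover have "list_encode l \<le> w"
    using Cons.prems le_prod_encode_2[of "list_encode l" z] by simp
  ultimately show ?case using Cons.IH by simp
qed simp

text \<open>Use principle: an oracle query \<open>x\<close> is a component of an entry of the list
  coded by \<open>w\<close>, hence smaller than \<open>w\<close>.\<close>

lemma T_cong: "(\<And>i. i < w \<Longrightarrow> i \<in> X \<longleftrightarrow> i \<in> Z) \<Longrightarrow> T X w c x y = T Z w c x y"
  unfolding T_def using derivation_cong[of w X Z "list_decode w"] by simp

lemma derivation_iff:
  "derivation X l \<longleftrightarrow> (\<forall>i<length l. justified X (set (drop (Suc i) l))
     (lft (entry l i)) (lft (rgt (entry l i))) (rgt (rgt (entry l i))))"
proof (induction l)
  case (Cons z l)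
  have "entry (z # l) (Suc i) = entry l i" "entry (z # l) 0 = z" for i
    by (auto simp: entry_def)
  then show ?case by (simp add: Cons All_less_Suc2)
qed simp

text \<open>Intermediate values occur in lines of the list coded by \<open>w\<close>, so
  \<open>w\<close> bounds the remaining quantifiers and the closure rules for decidable relations
  apply.\<close>

lemma justified_bounded:
  assumes S: "S = set (list_decode w)"
  shows "justified X S c x y \<longleftrightarrow>
     c = 0 \<and> y = 0 \<or> c = 1 \<and> y = Suc x \<or> c = 2 \<and> y = lft x \<or> c = 3 \<and> y = rgt x \<or>
     c = 4 \<and> y = of_bool (x \<in> X) \<or>
     (\<exists>f<c. \<exists>g<c. c = 4 * pr f g + 5 \<and> tr f x (lft y) \<in> S \<and> tr g x (rgt y) \<in> S) \<or>
     (\<exists>f<c. \<exists>g<c. c = 4 * pr f g + 6 \<and> (\<exists>m<w. tr g x m \<in> S \<and> tr f m y \<in> S)) \<or>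
     (\<exists>f<c. \<exists>g<c. c = 4 * pr f g + 7 \<and>
        (rgt x = 0 \<and> tr f (lft x) y \<in> S \<or>
         (\<exists>n<rgt x. rgt x = Suc n \<and>
            (\<exists>m<w. tr c (pr (lft x) n) m \<in> S \<and> tr g (pr (lft x) (pr n m)) y \<in> S)))) \<or>
     (\<exists>f<c. c = 4 * f + 8 \<and> tr f (pr x y) 0 \<in> S \<and> (\<forall>m<y. \<exists>k<w. tr f (pr x m) (Suc k) \<in> S))"
proof -
  have "(\<exists>m. tr g x m \<in> S \<and> P m) \<longleftrightarrow> (\<exists>m<w. tr g x m \<in> S \<and> P m)" for g x P
    using tr_mem_bounds(3) S by blast
  moreover have "(\<exists>k. tr f u (Suc k) \<in> S) \<longleftrightarrow> (\<exists>k<w. tr f u (Suc k) \<in> S)" for f u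
    using tr_mem_bounds(3) S Suc_lessD by blast
  ultimately show ?thesis unfolding justified_def by simp
qed

text \<open>The oracle is a member of a uniformly decidable family, so that the stages of an
  approximation can serve as oracles with the stage as an argument.\<close>

lemma dec_family:
  assumes "decidable Y (\<lambda>z. rgt z \<in> Os (lft z))" "recursive Y f" "recursive Y e"
  shows "decidable Y (\<lambda>x. f x \<in> Os (e x))"
  using rec_comp[OF assms(1) rec_pr[OF assms(3,2)]] by simp

lemma dec_justified:
  assumes os: "decidable Y (\<lambda>z. rgt z \<in> Os (lft z))"
    and "recursive Y e" "recursive Y w" "recursive Y c" "recursive Y x" "recursive Y y"
  shows "decidable Y (\<lambda>u. justified (Os (e u)) (set (list_decode (w u))) (c u) (x u) (y u))"
proof -
  \<comment> \<open>The relation is first decided with its arguments packed into one number;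
    composition with the packing function then admits arbitrary recursive arguments. The same device
    recurs below.\<close>
  have "decidable Y (\<lambda>u. justified (Os (lft u)) (set (list_decode (lft (rgt u))))
      (lft (rgt (rgt u))) (lft (rgt (rgt (rgt u)))) (rgt (rgt (rgt (rgt u)))))"
    unfolding justified_bounded[OF refl] by (intro rec_intros dec_family[OF os])
  moreover have "recursive Y (\<lambda>u. pr (e u) (pr (w u) (pr (c u) (pr (x u) (y u)))))"
    by (intro rec_intros assms)
  ultimately show ?thesis by (rule rec_comp[elim_format]) simp
qed

lemma dec_T:
  assumes os: "decidable Y (\<lambda>z. rgt z \<in> Os (lft z))"
    and "recursive Y e" "recursive Y w" "recursive Y c" "recursive Y x" "recursive Y y"
  shows "decidable Y (\<lambda>u. T (Os (e u)) (w u) (c u) (x u) (y u))"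
proof -
  have 1: "decidable Y (\<lambda>u. justified (Os (e u)) (set (l u)) (c u) (x u) (y u))"
    if "recursive Y e" "lrecursive Y l" "recursive Y c" "recursive Y x" "recursive Y y" for e l c x y
    using dec_justified[OF os that] by simp
  have "decidable Y (\<lambda>u. T (Os (lft u)) (lft (rgt u))
      (lft (rgt (rgt u))) (lft (rgt (rgt (rgt u)))) (rgt (rgt (rgt (rgt u)))))"
    unfolding T_def derivation_iff by (intro rec_intros 1)
  moreover have "recursive Y (\<lambda>u. pr (e u) (pr (w u) (pr (c u) (pr (x u) (y u)))))"
    by (intro rec_intros assms)
  ultimately show ?thesis by (rule rec_comp[elim_format]) simp
qed

subsection \<open>Computable approximations\<close>

definition halts_before :: "nat \<Rightarrow> nat \<Rightarrow> nat \<Rightarrow> bool" where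
  "halts_before c x t \<longleftrightarrow> (\<exists>w<t. \<exists>y<t. T {} w c x y)"

lemma halts_before_mono: "halts_before c x s \<Longrightarrow> s \<le> t \<Longrightarrow> halts_before c x t"
  unfolding halts_before_def by (meson order_less_le_trans)

lemma ex_halts_before: "(\<exists>t. halts_before (code_number c) x t) \<longleftrightarrow> (\<exists>y. computes {} c x y)"
  unfolding halts_before_def computes_iff_T by (meson less_Suc_eq_le max.cobounded1 max.cobounded2)

lemma dec_halts_before [rec_intros]:
  assumes "recursive Y c" "recursive Y x" "recursive Y t"
  shows "decidable Y (\<lambda>u. halts_before (c u) (x u) (t u))"
proof -
  have "decidable Y (\<lambda>z. rgt z \<in> (\<lambda>_. {}) (lft z))" using rec_const[of Y 0] by simp
  note 1 = dec_T[OF this rec_const]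
  have "decidable Y (\<lambda>u. halts_before (lft u) (lft (rgt u)) (rgt (rgt u)))"
    unfolding halts_before_def by (intro rec_intros 1)
  moreover have "recursive Y (\<lambda>u. pr (c u) (pr (x u) (t u)))"
    by (intro rec_intros assms)
  ultimately show ?thesis by (rule rec_comp[elim_format]) simp
qed

text \<open>Each member below \<open>b\<close> has entered by some stage and a nonmember never
  enters; the maximum of finitely many stages works.\<close>

lemma increasing_approximation_settles:
  fixes E :: "nat \<Rightarrow> nat set"
  assumes mono: "\<And>s t. s \<le> t \<Longrightarrow> E s \<subseteq> E t"
  obtains s where "\<And>t i. s \<le> t \<Longrightarrow> i < b \<Longrightarrow> i \<in> E t \<longleftrightarrow> i \<in> (\<Union>t. E t)"
proof -
  have "\<exists>s. \<forall>t\<ge>s. \<forall>i<b. i \<in> E t \<longleftrightarrow> i \<in> (\<Union>t. E t)"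
  proof (induction b)
    case (Suc b)
    then obtain s where s: "\<forall>t\<ge>s. \<forall>i<b. i \<in> E t \<longleftrightarrow> i \<in> (\<Union>t. E t)" by blast
    obtain r where "\<forall>t\<ge>r. b \<in> E t \<longleftrightarrow> b \<in> (\<Union>t. E t)"
    proof (cases "b \<in> (\<Union>t. E t)")
      case True
      then obtain r where "b \<in> E r" by blast
      then show ?thesis using mono True that[of r] by blast
    qed (use that in blast)
    with s show ?case by (intro exI[of _ "max r s"]) (auto simp: less_Suc_eq)
  qed simp
  then show ?thesis using that by blast
qed

definition jump_stage :: "nat \<Rightarrow> nat set" where
  "jump_stage t = {z. halts_before z z t}"

lemma jump_stage_mono: "s \<le> t \<Longrightarrow> jump_stage s \<subseteq> jump_stage t"
  unfolding jump_stage_def using halts_before_mono by blast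

lemma Union_jump_stage: "(\<Union>t. jump_stage t) = turing_jump {}"
proof -
  have "z \<in> (\<Union>t. jump_stage t) \<longleftrightarrow> z \<in> turing_jump {}" for z
  proof -
    obtain c where z: "z = code_number c" using ex_code_number by blast
    show ?thesis
      using ex_halts_before[of c z]
      by (auto simp: z jump_stage_def turing_jump_def code_number_eq_iff)
  qed
  then show ?thesis by blast
qed

definition jump_guess :: "nat \<Rightarrow> nat \<Rightarrow> nat \<Rightarrow> bool" where
  "jump_guess c x t \<longleftrightarrow> (\<exists>w<t. T (jump_stage t) w c x 1)"

text \<open>The limit lemma. Once the stages agree with the halting set below the true witness
  \<open>w\<close>, that computation persists, and determinism excludes every other output.\<close>

lemma jump_guess_limit:
  assumes c: "\<And>x. computes (turing_jump {}) c x (of_bool (x \<in> Z))"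
  shows "\<exists>s. \<forall>t\<ge>s. jump_guess (code_number c) x t \<longleftrightarrow> x \<in> Z"
proof -
  obtain w where w: "T (turing_jump {}) w (code_number c) x (of_bool (x \<in> Z))"
    using c[of x] unfolding computes_iff_T by blast
  obtain s where s: "\<And>t i. s \<le> t \<Longrightarrow> i < w \<Longrightarrow> i \<in> jump_stage t \<longleftrightarrow> i \<in> (\<Union>t. jump_stage t)"
    by (rule increasing_approximation_settles[of jump_stage w]) (use jump_stage_mono in blast)+
  note s = s[unfolded Union_jump_stage]
  have "jump_guess (code_number c) x t \<longleftrightarrow> x \<in> Z" if t: "max s (Suc w) \<le> t" for t
  proof -
    have T: "T (jump_stage t) w (code_number c) x (of_bool (x \<in> Z))"
      using T_cong[of w "jump_stage t" "turing_jump {}"] s w t by simp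
    then have "computes (jump_stage t) c x (of_bool (x \<in> Z))"
      unfolding computes_iff_T by blast
    then have uniq: "v = of_bool (x \<in> Z)" if "T (jump_stage t) w' (code_number c) x v" for w' v
      by (rule computes_deterministic[rotated]) (use that computes_iff_T in blast)
    show ?thesis
    proof (cases "x \<in> Z")
      case True
      then show ?thesis using T t unfolding jump_guess_def by (auto intro!: exI[of _ w])
    next
      case False
      then show ?thesis using uniq unfolding jump_guess_def by fastforce
    qed
  qed
  then show ?thesis by blast
qed

lemma dec_jump_guess [rec_intros]:
  assumes "recursive Y c" "recursive Y x" "recursive Y t"
  shows "decidable Y (\<lambda>u. jump_guess (c u) (x u) (t u))"
proof -
  have "decidable Y (\<lambda>z. rgt z \<in> jump_stage (lft z))"
    unfolding jump_stage_def mem_Collect_eq by (intro rec_intros)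
  note 1 = dec_T[OF this]
  have "decidable Y (\<lambda>u. jump_guess (lft u) (lft (rgt u)) (rgt (rgt u)))"
    unfolding jump_guess_def by (intro rec_intros 1)
  moreover have "recursive Y (\<lambda>u. pr (c u) (pr (x u) (t u)))"
    by (intro rec_intros assms)
  ultimately show ?thesis by (rule rec_comp[elim_format]) simp
qed

section \<open>Hard-wired inputs, as in the s-m-n theorem\<close>

primrec const_code :: "nat \<Rightarrow> code" where
  "const_code 0 = Zero"
| "const_code (Suc n) = Comp Succ (const_code n)"

lemma computes_const_code: "computes X (const_code n) x n"
  by (induction n) (auto intro: computes.intros)

text \<open>The composite ignores its input, so the diagonal question of the jump about it asks
  whether \<open>c\<close> halts on \<open>n\<close>.\<close>

lemma ex_computes_Comp_const:
  "(\<exists>y. computes X (Comp c (const_code n)) x y) \<longleftrightarrow> (\<exists>y. computes X c n y)"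
  by (metis computes.Comp computes_const_code computes_deterministic computes_elims(7))

lemma rec_const_code [rec_intros]:
  assumes "recursive Y f" shows "recursive Y (\<lambda>u. code_number (const_code (f u)))"
proof -
  have "recursive Y (\<lambda>u. rec_nat 0 (\<lambda>_ y. 4 * pr 1 y + 6) (f u))" by (intro rec_intros assms)
  moreover have "rec_nat 0 (\<lambda>_ y. 4 * pr 1 y + 6) n = code_number (const_code n)" for n
    by (induction n) auto
  ultimately show ?thesis by simp
qed

subsection \<open>Strings\<close>

definition str :: "nat \<Rightarrow> bool list" where "str = inv string_number"

lemma str_string_number [simp]: "str (string_number s) = s"
  using bij_string_number by (simp add: str_def bij_def)

lemma string_number_str [simp]: "string_number (str n) = n"
  using bij_string_number by (simp add: str_def bij_def surj_f_inv_f)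

lemma string_number_eq_0 [simp]: "string_number s = 0 \<longleftrightarrow> s = []"
  by (cases s) auto

lemma length_str_le: "length (str n) \<le> n"
proof -
  have "length s \<le> string_number s" for s by (induction s) auto
  then show ?thesis by (metis string_number_str)
qed

text \<open>Turns quantification over the strings of a given length into a bounded one.\<close>

lemma string_number_less: "string_number s < 2 ^ Suc (length s)"
proof -
  have "string_number s + 2 \<le> 2 ^ Suc (length s)" by (induction s) auto
  then show ?thesis by simp
qed

definition bit_at :: "nat \<Rightarrow> nat \<Rightarrow> bool" where
  "bit_at n i \<longleftrightarrow> i < length (str n) \<and> str n ! i"

lemma rec_string_drop:
  assumes "recursive Y n" "recursive Y i"
  shows "recursive Y (\<lambda>u. string_number (drop (i u) (str (n u))))"
proof -
  \<comment> \<open>For \<open>y > 0\<close> the minimum is the \<open>m\<close> with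
    \<open>y = 2 * m + 1\<close> or \<open>y = 2 * m + 2\<close>, that is, \<open>y\<close> without
    its first digit; for \<open>y = 0\<close> it is 0.\<close>
  have "recursive Y (\<lambda>u. rec_nat (n u) (\<lambda>_ y. LEAST m. y \<le> 2 * m + 2) (i u))"
    by (intro rec_intros assms) presburger
  moreover have "(LEAST m. string_number s \<le> 2 * m + 2) = string_number (tl s)" for s
    by (cases s) (auto intro: Least_equality)
  then have "rec_nat n (\<lambda>_ y. LEAST m. y \<le> 2 * m + 2) i = string_number (drop i (str n))" for n i
    by (induction i) (simp_all add: drop_Suc tl_drop)
  ultimately show ?thesis by simp
qed

lemma rec_length_str [rec_intros]:
  assumes "recursive Y n" shows "recursive Y (\<lambda>u. length (str (n u)))"
proof -
  have "recursive Y (\<lambda>n. LEAST i. string_number (drop i (str n)) = 0)"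
    by (intro rec_intros rec_string_drop) (auto intro: exI[of _ "length (str n)" for n])
  moreover have "(LEAST i. string_number (drop i s) = 0) = length s" for s
    by (rule Least_equality) auto
  ultimately have "recursive Y (\<lambda>n. length (str n))" by simp
  from rec_comp[OF this assms] show ?thesis .
qed

lemma dec_bit_at [rec_intros]:
  assumes "recursive Y n" "recursive Y i" shows "decidable Y (\<lambda>u. bit_at (n u) (i u))"
proof -
  \<comment> \<open>A nonempty string starts with the digit 2, standing for \<open>True\<close>,
    exactly when its number is even.\<close>
  have "decidable Y (\<lambda>u. lft u < length (str (rgt u)) \<and> (\<exists>m<string_number (drop (lft u) (str (rgt u))).
      string_number (drop (lft u) (str (rgt u))) = 2 * m))"
    by (intro rec_intros rec_string_drop)
  moreover have "bit_at n i \<longleftrightarrow> i < length (str n) \<and>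
      (\<exists>m<string_number (drop i (str n)). string_number (drop i (str n)) = 2 * m)" for n i
  proof (cases "i < length (str n)")
    case True
    then have "drop i (str n) = str n ! i # drop (Suc i) (str n)" by (simp add: Cons_nth_drop_Suc)
    then show ?thesis using True unfolding bit_at_def
      by (auto intro!: exI[of _ "Suc (string_number (drop (Suc i) (str n)))"] split: if_splits) presburger
  qed (simp add: bit_at_def)
  ultimately have "decidable Y (\<lambda>u. bit_at (rgt u) (lft u))" by simp
  from rec_comp[OF this rec_pr[OF assms(2,1)]] show ?thesis by simp
qed

section \<open>The finite injury construction\<close>

text \<open>
  The state of the construction at a stage is a list whose entry \<open>q\<close> is a triple: the stage at which
  strategy \<open>q\<close> was last initialized, the length of the strings that it wants to extend, and the stage at
  which its current extensions were accepted (\<open>0\<close> while it is waiting). Strategies are indexed by the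
  numbers of strings; those of the same level belong to the same requirement and act one after the
  other, so that at most one of them waits forever.
\<close>

abbreviation ver :: "nat \<Rightarrow> nat" where "ver e \<equiv> lft e"
abbreviation len :: "nat \<Rightarrow> nat" where "len e \<equiv> lft (rgt e)"
abbreviation acc :: "nat \<Rightarrow> nat" where "acc e \<equiv> rgt (rgt e)"

abbreviation level :: "nat \<Rightarrow> nat" where "level q \<equiv> length (str q)"

definition active :: "nat list \<Rightarrow> nat \<Rightarrow> bool" where
  "active l q \<longleftrightarrow> (\<forall>r<q. level r = level q \<longrightarrow> acc (entry l r) \<noteq> 0)"

text \<open>
  \<open>E\<close> approximates the oracle, \<open>pk S q n b\<close> says that below \<open>b\<close> there are extensions of all strings of
  length \<open>n\<close> as required by \<open>q\<close>, and \<open>gs q v t\<close> is the guess at stage \<open>t\<close> whether the strategy \<open>q\<close>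
  initialized at stage \<open>v\<close> is ever ready with a bound below which the approximation is correct.
\<close>

locale construction =
  fixes E :: "nat \<Rightarrow> nat set"
    and pk :: "nat set \<Rightarrow> nat \<Rightarrow> nat \<Rightarrow> nat \<Rightarrow> bool"
    and gs :: "nat \<Rightarrow> nat \<Rightarrow> nat \<Rightarrow> bool"
begin

definition has_bound :: "nat \<Rightarrow> nat \<Rightarrow> nat \<Rightarrow> bool" where
  "has_bound t q n \<longleftrightarrow> (\<exists>b\<le>t. pk (E t) q n b)"

text \<open>The alternative \<open>b = t\<close> guarantees a minimum; whenever
  \<open>has_bound\<close> holds, the value is the least proposal.\<close>

definition bound :: "nat \<Rightarrow> nat \<Rightarrow> nat \<Rightarrow> nat" where
  "bound t q n = (LEAST b. pk (E t) q n b \<or> b = t)"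

definition ready :: "nat \<Rightarrow> nat list \<Rightarrow> nat \<Rightarrow> bool" where
  "ready t l q \<longleftrightarrow> acc (entry l q) = 0 \<and> active l q \<and> has_bound t q (len (entry l q))"

definition attention :: "nat \<Rightarrow> nat list \<Rightarrow> nat \<Rightarrow> bool" where
  "attention t l q \<longleftrightarrow> ready t l q \<and> gs q (ver (entry l q)) t \<or>
     acc (entry l q) \<noteq> 0 \<and>
       \<not> (\<forall>i<bound (acc (entry l q)) q (len (entry l q)). i \<in> E (acc (entry l q)) \<longleftrightarrow> i \<in> E t)"

definition actor :: "nat \<Rightarrow> nat list \<Rightarrow> nat" where
  "actor t l = (LEAST q. attention t l q \<or> q = length l)"

text \<open>The three cases are initialization, acceptance and cancellation. Cancellation takes a
  fresh length but keeps the version: all attempts of one version share one question to the jump,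
  which is what limits their number.\<close>

definition new_entry :: "nat \<Rightarrow> nat list \<Rightarrow> nat \<Rightarrow> nat" where
  "new_entry t l q =
     (if q = length l then tr t (Suc t) 0
      else if acc (entry l q) = 0 then tr (ver (entry l q)) (len (entry l q)) t
      else tr (ver (entry l q)) (Suc t) 0)"

text \<open>Cutting the list at the actor injures all strategies of lower priority.\<close>

definition st :: "nat \<Rightarrow> nat list" where
  "st = rec_nat [] (\<lambda>t l. take (actor t l) l @ [new_entry t l (actor t l)])"

abbreviation "act t \<equiv> actor t (st t)"
abbreviation "en t q \<equiv> entry (st t) q"

lemma st_0 [simp]: "st 0 = []"
  and st_Suc: "st (Suc t) = take (act t) (st t) @ [new_entry t (st t) (act t)]"
  by (simp_all add: st_def)

lemma act_le: "act t \<le> length (st t)"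
  unfolding actor_def by (rule Least_le) simp

lemma act_cases: "act t = length (st t) \<or> attention t (st t) (act t)"
  unfolding actor_def by (rule LeastI2[of _ "length (st t)"]) auto

lemma act_le_attention: "attention t (st t) q \<Longrightarrow> act t \<le> q"
  unfolding actor_def by (rule Least_le) simp

lemma length_st_Suc: "length (st (Suc t)) = Suc (act t)"
  using act_le[of t] by (simp add: st_Suc)

lemma length_st: "length (st t) \<le> t"
proof (induction t)
  case (Suc t)
  then show ?case using act_le[of t] by (simp add: length_st_Suc)
qed simp

lemma en_below: "q < act t \<Longrightarrow> en (Suc t) q = en t q"
  using act_le[of t] by (auto simp: entry_def st_Suc nth_append)

lemma en_act: "en (Suc t) (act t) = new_entry t (st t) (act t)"
  using act_le[of t] by (auto simp: entry_def st_Suc nth_append)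

lemma active_below: "q \<le> act t \<Longrightarrow> active (st (Suc t)) q \<longleftrightarrow> active (st t) q"
  unfolding active_def using en_below by (auto simp: less_le_trans)

lemma new_entry_ver: "q \<noteq> length l \<Longrightarrow> ver (new_entry t l q) = ver (entry l q)"
  by (simp add: new_entry_def)

text \<open>A strategy is appended with an index at most the current stage, and each length it takes
  exceeds the stage of the choice. Hence only strategies \<open>q < n\<close> can want the length
  \<open>n\<close>.\<close>

lemma ver_bounds:
  "q < length (st t) \<Longrightarrow> q \<le> ver (en t q) \<and> ver (en t q) < len (en t q) \<and> len (en t q) \<le> t"
proof (induction t)
  case (Suc t)
  show ?case
  proof (cases "q < act t")
    case True
    then show ?thesis using Suc.IH act_le[of t] en_below[of q t] by simp
  next
    case False
    then have q: "q = act t" using Suc.prems length_st_Suc by simp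
    show ?thesis
    proof (cases "q = length (st t)")
      case True
      then show ?thesis using length_st[of t] en_act[of t] q by (simp add: new_entry_def)
    next
      case False
      then have "q < length (st t)" using act_le[of t] q by simp
      then show ?thesis using Suc.IH en_act[of t] q by (auto simp: new_entry_def)
    qed
  qed
qed simp

text \<open>An action below \<open>q\<close> removes \<open>q\<close> from the list, so its present
  version started later.\<close>

lemma ver_after_injury:
  "s < t \<Longrightarrow> act s < q \<Longrightarrow> q < length (st t) \<Longrightarrow> s < ver (en t q)"
proof (induction t)
  case (Suc t)
  show ?case
  proof (cases "q < act t")
    case True
    then have "s \<noteq> t" using Suc.prems by auto
    then show ?thesis using True Suc act_le[of t] en_below[of q t] by simp
  next
    case False
    then have q: "q = act t" using Suc.prems length_st_Suc by simp
    then have s: "s < t" using Suc.prems by (metis less_SucE less_irrefl)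
    show ?thesis
    proof (cases "q = length (st t)")
      case True
      then show ?thesis using s en_act[of t] q by (simp add: new_entry_def)
    next
      case False
      then have "q < length (st t)" using act_le[of t] q by simp
      then show ?thesis
        using Suc.IH[OF s Suc.prems(2)] en_act[of t] q new_entry_ver[of q "st t" t] False by simp
    qed
  qed
qed simp

text \<open>The acceptance was the last change of this entry, as any later action of
  \<open>q\<close> or of a smaller strategy would have replaced or removed it.\<close>

lemma accepted_history:
  assumes "q < length (st t)" and "acc (en t q) \<noteq> 0"
  defines "a \<equiv> acc (en t q)"
  shows "a < t" and "act a = q" and "q < length (st a)" and "ready a (st a) q"
    and "ver (en a q) = ver (en t q)" and "len (en a q) = len (en t q)"
    and "\<And>s. a < s \<Longrightarrow> s \<le> t \<Longrightarrow> q < length (st s) \<and> en s q = en t q"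
proof -
  have "a < t \<and> act a = q \<and> q < length (st a) \<and> ready a (st a) q \<and> ver (en a q) = ver (en t q) \<and>
      len (en a q) = len (en t q) \<and> (\<forall>s. a < s \<longrightarrow> s \<le> t \<longrightarrow> q < length (st s) \<and> en s q = en t q)"
    using assms(1,2) unfolding a_def
  proof (induction t)
    case (Suc t)
    show ?case
    proof (cases "q < act t")
      case True
      then have len: "q < length (st t)" using act_le[of t] by simp
      note e = en_below[OF True]
      note IH = Suc.IH[OF len Suc.prems(2)[unfolded e]]
      have "q < length (st s) \<and> en s q = en t q" if "acc (en t q) < s" "s \<le> Suc t" for s
        using IH that Suc.prems(1) e by (cases "s = Suc t") (blast dest: le_SucE)+
      with IH show ?thesis unfolding e by (blast intro: less_SucI)
    next
      case False
      then have q: "q = act t" using Suc.prems length_st_Suc by simp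
      have *: "q \<noteq> length (st t)" "acc (en t q) = 0" and e: "en (Suc t) q = tr (ver (en t q)) (len (en t q)) t"
        using Suc.prems en_act[of t] unfolding q[symmetric]
        by (auto simp: new_entry_def split: if_splits)
      have len: "q < length (st t)" using * act_le[of t] q by simp
      have rd: "ready t (st t) q" using act_cases[of t] * unfolding q[symmetric] attention_def by simp
      have a: "acc (en (Suc t) q) = t" using e by simp
      have last: "q < length (st s) \<and> en s q = en (Suc t) q" if "t < s" "s \<le> Suc t" for s
        using that Suc.prems(1) by (metis le_antisym Suc_leI)
      have "t < Suc t \<and> act t = q \<and> q < length (st t) \<and> ready t (st t) q \<and>
          ver (en t q) = ver (en (Suc t) q) \<and> len (en t q) = len (en (Suc t) q)"
        using e q len rd by simp
      then show ?thesis unfolding a using last by blast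
    qed
  qed simp
  note * = this
  show "a < t" using * by (elim conjE)
  show "act a = q" using * by (elim conjE)
  show "q < length (st a)" using * by (elim conjE)
  show "ready a (st a) q" using * by (elim conjE)
  show "ver (en a q) = ver (en t q)" using * by (elim conjE)
  show "len (en a q) = len (en t q)" using * by (elim conjE)
  show "q < length (st s) \<and> en s q = en t q" if "a < s" "s \<le> t" for s
    using * that by (elim conjE allE[of _ s]) iprover
qed

end

text \<open>The assumption \<open>gs_limit\<close> is self-referential: the guesses converge to the
  truth about the construction that they steer. \<open>pk_cong\<close> is the use principle for
  proposals.\<close>

locale lowness_construction = construction E pk gs
  for E :: "nat \<Rightarrow> nat set"
    and pk :: "nat set \<Rightarrow> nat \<Rightarrow> nat \<Rightarrow> nat \<Rightarrow> bool"
    and gs :: "nat \<Rightarrow> nat \<Rightarrow> nat \<Rightarrow> bool" +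
  fixes A :: "nat set"
  assumes E_mono: "s \<le> t \<Longrightarrow> E s \<subseteq> E t"
    and Union_E: "(\<Union>t. E t) = A"
    and pk_cong: "(\<And>i. i < b \<Longrightarrow> i \<in> S \<longleftrightarrow> i \<in> S') \<Longrightarrow> pk S q n b = pk S' q n b"
    and gs_limit: "\<exists>s. \<forall>t\<ge>s. gs q v t \<longleftrightarrow> (\<exists>u. q < length (st u) \<and> ver (en u q) = v \<and> ready u (st u) q \<and>
          (\<forall>i<bound u q (len (en u q)). i \<in> E u \<longleftrightarrow> i \<in> A))"
begin

section \<open>Stability of true proposals\<close>

lemma E_settles: obtains s where "\<And>t i. s \<le> t \<Longrightarrow> i < b \<Longrightarrow> i \<in> E t \<longleftrightarrow> i \<in> A"
  using increasing_approximation_settles[of E b] E_mono unfolding Union_E by metis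

lemma E_between: "i \<in> E s \<longleftrightarrow> i \<in> A \<Longrightarrow> s \<le> t \<Longrightarrow> i \<in> E t \<longleftrightarrow> i \<in> A"
  using E_mono Union_E by blast

lemma has_boundD:
  assumes "has_bound t q n"
  shows "pk (E t) q n (bound t q n)" and "bound t q n \<le> t"
    and "\<And>b. b < bound t q n \<Longrightarrow> \<not> pk (E t) q n b"
proof -
  obtain b where b: "b \<le> t" "pk (E t) q n b" using assms unfolding has_bound_def by blast
  have "pk (E t) q n (bound t q n) \<or> bound t q n = t"
    unfolding bound_def by (rule LeastI[of _ t]) simp
  moreover have "bound t q n \<le> b" unfolding bound_def by (rule Least_le) (use b in simp)
  ultimately show "pk (E t) q n (bound t q n)" "bound t q n \<le> t"
    using b by (auto simp: le_antisym)
  show "\<not> pk (E t) q n b" if "b < bound t q n" for b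
    using not_less_Least[OF that[unfolded bound_def]] by blast
qed

lemma bound_eqI:
  assumes "pk (E t) q n b" "b \<le> t" "\<And>b'. b' < b \<Longrightarrow> \<not> pk (E t) q n b'"
  shows "has_bound t q n" and "bound t q n = b"
proof -
  show "has_bound t q n" using assms unfolding has_bound_def by blast
  show "bound t q n = b"
    unfolding bound_def by (rule Least_equality) (use assms in \<open>auto simp: not_less[symmetric]\<close>)
qed

text \<open>\<open>E\<close> only grows towards \<open>A\<close>, so a correct part stays correct,
  and whether a number up to the bound is a proposal depends only on that part.\<close>

lemma bound_true_persists:
  assumes "has_bound s q n" "\<And>i. i < bound s q n \<Longrightarrow> i \<in> E s \<longleftrightarrow> i \<in> A" "s \<le> t"
  shows "has_bound t q n" and "bound t q n = bound s q n"
proof -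
  have eq: "pk (E t) q n b = pk (E s) q n b" if "b \<le> bound s q n" for b
    using assms(2) E_between[OF assms(2) assms(3)] that by (intro pk_cong) auto
  note * = has_boundD[OF assms(1)]
  show "has_bound t q n" "bound t q n = bound s q n"
    by (rule bound_eqI[of t q n "bound s q n"]; use * eq assms(3) in auto)+
qed

text \<open>
  Within one version of \<open>q\<close>, an acceptance that rests on a true computation is final, and if there is
  none then the guesses eventually stop the false acceptances.
\<close>

lemma settled_step:
  assumes t0: "\<And>t. t0 \<le> t \<Longrightarrow> q \<le> act t"
  shows "\<exists>t1. \<forall>t\<ge>t1. q < act t"
proof (rule ccontr)
  assume "\<nexists>t1. \<forall>t\<ge>t1. q < act t"
  then have inf: "\<exists>t\<ge>s. act t = q" for s
    using t0 by (metis le_neq_implies_less max.bounded_iff max.cobounded1 max.cobounded2)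
  have len: "q < length (st t)" if t: "Suc t0 \<le> t" for t
  proof -
    obtain u where "t = Suc u" "t0 \<le> u" using t by (cases t) auto
    then show ?thesis using t0[of u] length_st_Suc[of u] by simp
  qed
  have unchanged: "en u q = en s q" if "Suc t0 \<le> s" "s \<le> u" "\<And>r. s \<le> r \<Longrightarrow> r < u \<Longrightarrow> act r \<noteq> q" for s u
    using that(2,3)
  proof (induction u rule: dec_induct)
    case (step r)
    have "q \<le> act r" using t0[of r] that(1) step by simp
    moreover have "act r \<noteq> q" using step.prems[of r] step.hyps by simp
    ultimately have "q < act r" by simp
    then show ?case using step en_below[of q r] by simp
  qed simp
  have acts: "en (Suc t) q = new_entry t (st t) q" "attention t (st t) q" "q \<noteq> length (st t)"
    if "Suc t0 \<le> t" "act t = q" for t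
    using that en_act[of t] act_cases[of t] len[of t] by auto
  define v where "v = ver (en (Suc t0) q)"
  have ver: "ver (en t q) = v" if "Suc t0 \<le> t" for t
    using that
  proof (induction t rule: dec_induct)
    case (step r)
    show ?case
    proof (cases "act r = q")
      case True
      then show ?thesis using acts[of r] step new_entry_ver[of q "st r" r] by simp
    next
      case False
      then have "q < act r" using t0[of r] step by simp
      then show ?thesis using step en_below[of q r] by simp
    qed
  qed (simp add: v_def)
  have next_act: "\<exists>u>t. act u = q \<and> en u q = new_entry t (st t) q" if "Suc t0 \<le> t" "act t = q" for t
  proof -
    define u where "u = (LEAST u. t < u \<and> act u = q)"
    have u: "t < u \<and> act u = q"
      unfolding u_def by (rule LeastI_ex) (use inf[of "Suc t"] in \<open>auto simp: Suc_le_eq\<close>)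
    have "act r \<noteq> q" if "t < r" "r < u" for r
      using not_less_Least[OF that(2)[unfolded u_def]] that(1) by blast
    then have "en u q = en (Suc t) q"
      using u that(1) by (intro unchanged) auto
    then show ?thesis using u acts[OF that] by auto
  qed
  \<comment> \<open>Acceptances and cancellations of \<open>q\<close> alternate, so infinitely many
    actions include infinitely many acceptances, each of which has a positive guess.\<close>
  have guesses: "\<exists>t\<ge>s. gs q v t" for s
  proof -
    obtain t where t: "max s (Suc t0) \<le> t" "act t = q" using inf by blast
    show ?thesis
    proof (cases "acc (en t q) = 0")
      case True
      then show ?thesis using acts[of t] t ver[of t] unfolding attention_def by auto
    next
      case False
      obtain u where u: "t < u" "act u = q" "en u q = new_entry t (st t) q"
        using next_act[of t] t by auto
      then have "acc (en u q) = 0" using False acts(3)[of t] t by (simp add: new_entry_def)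
      then show ?thesis using acts[of u] t u ver[of u] unfolding attention_def by (intro exI[of _ u]) auto
    qed
  qed
  obtain u where u: "q < length (st u)" "ver (en u q) = v" "ready u (st u) q"
    and true: "\<And>i. i < bound u q (len (en u q)) \<Longrightarrow> i \<in> E u \<longleftrightarrow> i \<in> A"
    using gs_limit[of q v] guesses by blast
  \<comment> \<open>By the choice of \<open>t0\<close> an injury would occur at some
    \<open>s \<le> t0\<close>, and the version \<open>v\<close> present afterwards would exceed
    \<open>s\<close>; but \<open>v < u\<close>.\<close>
  have no_injury: "q \<le> act s" if "u \<le> s" for s
  proof (rule ccontr)
    assume *: "\<not> q \<le> act s"
    then have "s < Suc t0" using t0[of s] by linarith
    then have "s < v"
      using ver_after_injury[of s "Suc t0" q] * len[of "Suc t0"] ver[of "Suc t0"] by simp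
    moreover have "v < u" using ver_bounds[OF u(1)] u(2) by linarith
    ultimately show False using that by simp
  qed
  define n where "n = len (en u q)"
  have hb: "has_bound t q n" "bound t q n = bound u q n" if "u \<le> t" for t
    using bound_true_persists[OF _ true[folded n_def] that] u(3) unfolding ready_def n_def by blast+
  \<comment> \<open>With length \<open>n\<close>, acceptances from stage \<open>u\<close> on rest on
    the bound found at \<open>u\<close>, below which the approximation is already final; so they are
    never cancelled.\<close>
  have valid: "\<not> attention t (st t) q" if "u \<le> acc (en t q)" "acc (en t q) \<noteq> 0" "len (en t q) = n" "u \<le> t" for t
    using that hb(2)[OF that(1)] E_between[OF true] unfolding attention_def ready_def n_def[symmetric] by auto
  have state: "q < length (st t) \<and> len (en t q) = n \<and> (acc (en t q) = 0 \<or> u \<le> acc (en t q))" if "u \<le> t" for t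
    using that
  proof (induction t rule: dec_induct)
    case base
    then show ?case using u unfolding ready_def n_def by simp
  next
    case (step r)
    show ?case
    proof (cases "act r = q")
      case True
      then have "attention r (st r) q" using act_cases[of r] step by auto
      then have "acc (en r q) = 0" using valid[of r] step by auto
      then show ?thesis
        using step True en_act[of r] length_st_Suc[of r] by (auto simp: new_entry_def)
    next
      case False
      then have "q < act r" using no_injury[of r] step by simp
      then show ?thesis using step en_below[of q r] length_st_Suc[of r] by simp
    qed
  qed
  obtain t where t: "max u (Suc t0) \<le> t" "act t = q" using inf by blast
  have att: "attention t (st t) q" using acts t by simp
  then have "acc (en t q) = 0" using valid[of t] state[of t] t by auto
  obtain r where r: "t < r" "act r = q" "en r q = new_entry t (st t) q" using next_act[of t] t by auto
  then have "acc (en r q) = t" using \<open>acc (en t q) = 0\<close> acts(3)[of t] t by (simp add: new_entry_def)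
  moreover have "attention r (st r) q" using acts r t by simp
  ultimately show False using valid[of r] state[of r] r t by auto
qed

lemma settled: "\<exists>t0. \<forall>t\<ge>t0. q < act t"
proof (induction q)
  case 0
  show ?case using settled_step[of 0 0] by simp
next
  case (Suc q)
  then show ?case using settled_step[of _ "Suc q"] by (metis Suc_leI)
qed

section \<open>The limit of the construction\<close>

definition final :: "nat \<Rightarrow> nat" where
  "final q = en (Suc (SOME t0. \<forall>t\<ge>t0. q < act t)) q"

lemma final_entry: "\<exists>t0. \<forall>t\<ge>t0. q < length (st t) \<and> q < act t \<and> en t q = final q"
proof -
  define t0 where "t0 = (SOME t0. \<forall>t\<ge>t0. q < act t)"
  have t0: "q < act t" if "t0 \<le> t" for t
    using someI_ex[OF settled[of q]] that unfolding t0_def by blast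
  have "en t q = final q" if "Suc t0 \<le> t" for t
    using that
  proof (induction t rule: dec_induct)
    case (step r)
    then show ?case using t0[of r] en_below[of q r] by simp
  qed (simp add: final_def t0_def)
  moreover have "q < length (st t)" if "t0 \<le> t" for t using t0[OF that] act_le[of t] by simp
  ultimately show ?thesis using t0 by (intro exI[of _ "Suc t0"]) auto
qed

lemma final_entries: "\<exists>t0. \<forall>t\<ge>t0. \<forall>r<q. r < length (st t) \<and> r < act t \<and> en t r = final r"
proof (induction q)
  case (Suc q)
  then obtain t0 where "\<forall>t\<ge>t0. \<forall>r<q. r < length (st t) \<and> r < act t \<and> en t r = final r" by blast
  moreover obtain t1 where "\<forall>t\<ge>t1. q < length (st t) \<and> q < act t \<and> en t q = final q"
    using final_entry by blast
  ultimately show ?case by (intro exI[of _ "max t0 t1"]) (auto simp: less_Suc_eq)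
qed simp

definition stuck :: "nat \<Rightarrow> bool" where
  "stuck q \<longleftrightarrow> acc (final q) = 0 \<and> (\<forall>r<q. level r = level q \<longrightarrow> acc (final r) \<noteq> 0)"

text \<open>Of two stuck strategies in one level the smaller would have to be accepted. This
  uniqueness yields the probability bound 2^-k for level \<open>k\<close>.\<close>

lemma stuck_unique: "stuck q \<Longrightarrow> stuck r \<Longrightarrow> level q = level r \<Longrightarrow> q = r"
  unfolding stuck_def by (metis nat_neq_iff)

lemma not_accepted_imp_stuck:
  assumes "acc (final q) = 0" shows "\<exists>r. level r = level q \<and> stuck r"
proof -
  define r where "r = (LEAST r. level r = level q \<and> acc (final r) = 0)"
  have "level r = level q \<and> acc (final r) = 0"
    unfolding r_def by (rule LeastI[of _ q]) (use assms in simp)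
  moreover have "acc (final r') \<noteq> 0" if "r' < r" "level r' = level r" for r'
    using not_less_Least[OF that(1)[unfolded r_def]] that calculation by simp
  ultimately show ?thesis unfolding stuck_def by auto
qed

text \<open>Otherwise, after all strategies up to \<open>q\<close> have settled, \<open>q\<close> is
  ready with a true bound, the guesses become positive, and \<open>q\<close> would act once
  more.\<close>

lemma stuck_imp_no_bound:
  assumes "stuck q" shows "\<not> pk A q (len (final q)) b"
proof
  define n where "n = len (final q)"
  define v where "v = ver (final q)"
  assume "pk A q (len (final q)) b"
  then have "pk A q n b" by (simp add: n_def)
  define c where "c = (LEAST b. pk A q n b)"
  have c: "pk A q n c" unfolding c_def using \<open>pk A q n b\<close> by (rule LeastI)
  have c_min: "\<not> pk A q n b'" if "b' < c" for b' using not_less_Least that unfolding c_def by blast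
  obtain s where s: "\<And>t i. s \<le> t \<Longrightarrow> i < c \<Longrightarrow> i \<in> E t \<longleftrightarrow> i \<in> A" using E_settles by blast
  obtain t0 where t0: "\<And>t r. t0 \<le> t \<Longrightarrow> r < Suc q \<Longrightarrow> r < length (st t) \<and> r < act t \<and> en t r = final r"
    using final_entries[of "Suc q"] by blast
  define u where "u = max c (max s t0)"
  have *: "has_bound t q n" "bound t q n = c" if "u \<le> t" for t
  proof -
    have "pk (E t) q n b' = pk A q n b'" if "b' \<le> c" for b'
      using \<open>u \<le> t\<close> that s unfolding u_def by (intro pk_cong) auto
    then show "has_bound t q n" "bound t q n = c"
      using that c c_min by (intro bound_eqI[of t q n c]; auto simp: u_def)+
  qed
  have ready: "ready t (st t) q" if "u \<le> t" for t
    using t0[of t] that assms *(1)[OF that]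
    unfolding ready_def active_def stuck_def n_def u_def by auto
  have "\<exists>u. q < length (st u) \<and> ver (en u q) = v \<and> ready u (st u) q \<and>
      (\<forall>i<bound u q (len (en u q)). i \<in> E u \<longleftrightarrow> i \<in> A)"
    using t0[of u q] ready[of u] *(2)[of u] s[of u] unfolding v_def n_def
    by (intro exI[of _ u]) (auto simp: u_def)
  then obtain r where r: "\<And>t. r \<le> t \<Longrightarrow> gs q v t" using gs_limit[of q v] by blast
  define t where "t = max u r"
  have "attention t (st t) q"
    using ready[of t] r[of t] t0[of t q] unfolding attention_def v_def by (auto simp: t_def u_def)
  then have "act t \<le> q" by (rule act_le_attention)
  moreover have "t0 \<le> t" by (simp add: t_def u_def le_max_iff_disj)
  ultimately show False using t0[of t q] by simp
qed

text \<open>A wrong value of the approximation below the bound would eventually show and make the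
  settled strategy act again.\<close>

lemma final_accepted:
  assumes "acc (final q) \<noteq> 0"
  defines "a \<equiv> acc (final q)" and "n \<equiv> len (final q)"
  shows "act a = q" and "q < length (st a)" and "ready a (st a) q" and "len (en a q) = n"
    and "\<And>s. a < s \<Longrightarrow> q < length (st s) \<and> en s q = final q"
    and "pk A q n (bound a q n)" and "bound a q n \<le> a"
    and "\<And>i. i < bound a q n \<Longrightarrow> i \<in> E a \<longleftrightarrow> i \<in> A"
proof -
  obtain t0 where t0: "\<And>t. t0 \<le> t \<Longrightarrow> q < length (st t) \<and> q < act t \<and> en t q = final q"
    using final_entry by blast
  define t where "t = max t0 (Suc a)"
  have t: "q < length (st t)" "en t q = final q" using t0[of t] by (simp_all add: t_def)
  note h = accepted_history[OF t(1), unfolded t(2), OF assms(1), folded a_def n_def]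
  show "act a = q" "q < length (st a)" "ready a (st a) q" "len (en a q) = n"
    using h by blast+
  show "q < length (st s) \<and> en s q = final q" if "a < s" for s
    using h(7)[OF that] t0[of s] by (cases "s \<le> t") (auto simp: t_def)
  have hb: "has_bound a q n" using h(4,6) unfolding ready_def by simp
  have agree: "\<forall>i<bound a q n. i \<in> E a \<longleftrightarrow> i \<in> E s" if "t0 \<le> s" for s
  proof (rule ccontr)
    assume "\<not> ?thesis"
    then have "attention s (st s) q"
      unfolding attention_def using t0[OF that] assms(1) unfolding a_def n_def by simp
    from act_le_attention[OF this] show False using t0[OF that] by simp
  qed
  obtain s where s: "\<And>t i. s \<le> t \<Longrightarrow> i < bound a q n \<Longrightarrow> i \<in> E t \<longleftrightarrow> i \<in> A"
    using E_settles by blast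
  show true: "i \<in> E a \<longleftrightarrow> i \<in> A" if "i < bound a q n" for i
    using agree[of "max s t0"] s[of "max s t0"] that by simp
  show "pk A q n (bound a q n)" using has_boundD(1)[OF hb] pk_cong[OF true] by simp
  show "bound a q n \<le> a" using has_boundD(2)[OF hb] .
qed

end

subsection \<open>The set computed from an oracle\<close>

context construction
begin

definition blocked :: "(nat \<Rightarrow> bool) \<Rightarrow> nat list \<Rightarrow> nat list \<Rightarrow> bool" where
  "blocked ow l p \<longleftrightarrow>
     (\<exists>q<length l. ow q \<and> acc (entry l q) = 0 \<and> active l q \<and> len (entry l q) \<le> length p)"

text \<open>Positions on which no accepted owned strategy insists get the bit 0.\<close>

definition new_bit :: "(nat \<Rightarrow> nat \<Rightarrow> nat list \<Rightarrow> nat) \<Rightarrow> (nat \<Rightarrow> bool) \<Rightarrow> nat list \<Rightarrow> nat list \<Rightarrow> bool" where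
  "new_bit ext ow l p \<longleftrightarrow>
     (\<exists>q<length l. ow q \<and> acc (entry l q) \<noteq> 0 \<and> len (entry l q) \<le> length p \<and>
        bit_at (ext (acc (entry l q)) q (take (len (entry l q)) p)) (length p))"

definition path :: "(nat \<Rightarrow> nat \<Rightarrow> nat list \<Rightarrow> nat) \<Rightarrow> (nat \<Rightarrow> bool) \<Rightarrow> nat \<Rightarrow> nat list" where
  "path ext ow = rec_nat []
     (\<lambda>t p. if blocked ow (st t) p then p else p @ [of_bool (new_bit ext ow (st t) p)])"

definition path_set :: "(nat \<Rightarrow> nat \<Rightarrow> nat list \<Rightarrow> nat) \<Rightarrow> (nat \<Rightarrow> bool) \<Rightarrow> nat set" where
  "path_set ext ow = {i. \<exists>t. i < length (path ext ow t) \<and> path ext ow t ! i \<noteq> 0}"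

end

text \<open>\<open>ow\<close> selects the strategies that the oracle follows. By
  \<open>level_ext\<close> an extension accepted at stage \<open>a\<close> prescribes no position
  from \<open>a\<close> on, which keeps the strategies from interfering.\<close>

locale path_construction = lowness_construction E pk gs A
  for E :: "nat \<Rightarrow> nat set"
    and pk :: "nat set \<Rightarrow> nat \<Rightarrow> nat \<Rightarrow> nat \<Rightarrow> bool"
    and gs :: "nat \<Rightarrow> nat \<Rightarrow> nat \<Rightarrow> bool"
    and A :: "nat set" +
  fixes ext :: "nat \<Rightarrow> nat \<Rightarrow> nat list \<Rightarrow> nat"
    and ow :: "nat \<Rightarrow> bool"
  assumes level_ext: "length (str (ext a q p)) \<le> a"
    and not_stuck: "ow q \<Longrightarrow> \<not> stuck q"
begin

abbreviation "pa t \<equiv> path ext ow t"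

lemma path_0 [simp]: "pa 0 = []"
  and path_Suc: "pa (Suc t) =
    (if blocked ow (st t) (pa t) then pa t else pa t @ [of_bool (new_bit ext ow (st t) (pa t))])"
  by (simp_all add: path_def)

lemma length_path: "length (pa t) \<le> t"
  by (induction t) (auto simp: path_Suc)

lemma path_take: "s \<le> t \<Longrightarrow> \<exists>p. pa t = pa s @ p"
proof (induction t rule: dec_induct)
  case (step r)
  then show ?case by (auto simp: path_Suc)
qed simp

text \<open>A fresh length is never below the length of the path, and the path stops there while
  \<open>q\<close> waits. Activity cannot change silently, because an action of a smaller strategy
  removes \<open>q\<close>.\<close>

lemma waiting_ahead:
  "q < length (st t) \<Longrightarrow> ow q \<Longrightarrow> acc (en t q) = 0 \<Longrightarrow> active (st t) q \<Longrightarrow> length (pa t) \<le> len (en t q)"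
proof (induction t)
  case (Suc t)
  show ?case
  proof (cases "q < act t")
    case True
    then have *: "en (Suc t) q = en t q" "active (st t) q" "q < length (st t)"
      using en_below active_below[of q t] Suc.prems act_le[of t] by auto
    then have "length (pa t) \<le> len (en t q)" using Suc by simp
    moreover have "blocked ow (st t) (pa t)" if "length (pa t) = len (en t q)"
      unfolding blocked_def using * Suc.prems that by auto
    ultimately show ?thesis unfolding * by (auto simp: path_Suc Suc_le_eq le_less)
  next
    case False
    then have q: "q = act t" using Suc.prems length_st_Suc by simp
    \<comment> \<open>An acceptance at stage 0 would be recorded as waiting; the empty initial list
      excludes it.\<close>
    have "t \<noteq> 0" if "q \<noteq> length (st t)" using that act_le[of t] q by (metis le_zero_eq list.size(3) st_0)
    then have "len (en (Suc t) q) = Suc t"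
      using Suc.prems(3) en_act[of t] unfolding q[symmetric] by (auto simp: new_entry_def split: if_splits)
    then show ?thesis using length_path[of "Suc t"] by simp
  qed
qed simp

text \<open>A path that stops growing is blocked by a strategy with an index below its length; once
  all of those have settled, the blocking one is stuck, contrary to
  \<open>not_stuck\<close>.\<close>

lemma path_unbounded: "\<exists>t. m < length (pa t)"
proof (rule ccontr)
  assume "\<nexists>t. m < length (pa t)"
  then have "\<forall>t. length (pa t) < Suc m" by (auto simp: not_less less_Suc_eq_le)
  then obtain s where s: "\<And>t. length (pa t) \<le> length (pa s)"
    using ex_has_greatest_nat[of "\<lambda>_. True" 0 "\<lambda>t. length (pa t)" "Suc m"] by auto
  have const: "pa t = pa s" if "s \<le> t" for t
    using path_take[OF that] s[of t] by auto
  obtain t0 where t0: "\<And>t r. t0 \<le> t \<Longrightarrow> r < length (pa s) \<Longrightarrow> r < length (st t) \<and> r < act t \<and> en t r = final r"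
    using final_entries by blast
  define t where "t = max s t0"
  have "pa (Suc t) = pa t" using const[of t] const[of "Suc t"] by (simp add: t_def)
  then have "blocked ow (st t) (pa t)" by (auto simp: path_Suc split: if_splits)
  then obtain q where q: "q < length (st t)" "ow q" "acc (en t q) = 0" "active (st t) q"
    "len (en t q) \<le> length (pa s)"
    unfolding blocked_def using const[of t] by (auto simp: t_def)
  then have "q < length (pa s)" using ver_bounds[OF q(1)] by linarith
  then have "stuck q"
    using q t0[of t] unfolding stuck_def active_def by (auto simp: t_def)
  then show False using not_stuck q(2) by blast
qed

lemma path_nth: "s \<le> t \<Longrightarrow> i < length (pa s) \<Longrightarrow> pa t ! i = pa s ! i"
  using path_take[of s t] by (auto simp: nth_append)

lemma path_set_iff: "i < length (pa t) \<Longrightarrow> i \<in> path_set ext ow \<longleftrightarrow> pa t ! i \<noteq> 0"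
proof -
  assume i: "i < length (pa t)"
  have "pa s ! i = pa t ! i" if "i < length (pa s)" for s
    using path_nth[of s t i] path_nth[of t s i] i that by (cases "s \<le> t") auto
  then show ?thesis using i unfolding path_set_def mem_Collect_eq by metis
qed

text \<open>Up to the acceptance the path has not passed the length \<open>n\<close>; afterwards no
  other strategy prescribes bits between \<open>n\<close> and the end of the extension.\<close>

lemma path_follows:
  assumes q: "ow q" "acc (final q) \<noteq> 0"
  defines "a \<equiv> acc (final q)" and "n \<equiv> len (final q)"
  shows "\<forall>i<length (pa t). n \<le> i \<longrightarrow> i < level (ext a q (take n (pa t))) \<longrightarrow>
    (pa t ! i \<noteq> 0 \<longleftrightarrow> bit_at (ext a q (take n (pa t))) i)"
proof (cases "t \<le> Suc a")
  note f = final_accepted[OF q(2), folded a_def n_def]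
  have ra: "acc (en a q) = 0" "active (st a) q" using f(3) unfolding ready_def by simp_all
  have "length (pa a) \<le> n" using waiting_ahead[OF f(2) q(1) ra] f(4) by simp
  moreover have "blocked ow (st a) (pa a)" if "length (pa a) = n"
    unfolding blocked_def using f(2,4) q(1) ra that by auto
  ultimately have short: "length (pa (Suc a)) \<le> n" by (auto simp: path_Suc Suc_le_eq le_less)
  {
    case True
    then have "length (pa t) \<le> n" using path_take[OF True] short by auto
    then show ?thesis by auto
  next
    case False
    then have "Suc a \<le> t" by simp
    then show ?thesis
    proof (induction t rule: dec_induct)
      case base
      then show ?case using short by auto
    next
      case (step t)
      let ?L = "length (pa t)"
      let ?x = "ext a q (take n (pa t))"
      have new: "new_bit ext ow (st t) (pa t) \<longleftrightarrow> bit_at ?x ?L" if L: "n \<le> ?L" "?L < level ?x"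
      proof
        have La: "?L < a" using L(2) level_ext[of a q "take n (pa t)"] by simp
        assume "new_bit ext ow (st t) (pa t)"
        then obtain r where r: "r < length (st t)" "ow r" "acc (en t r) \<noteq> 0" "len (en t r) \<le> ?L"
          and bit: "bit_at (ext (acc (en t r)) r (take (len (en t r)) (pa t))) ?L"
          unfolding new_bit_def by blast
        have "r = q"
        proof (rule linorder_cases[of r q])
          \<comment> \<open>Since \<open>q\<close> has survived, \<open>r\<close> was accepted
            before the version of \<open>q\<close> started, so the extension of \<open>r\<close>
            ends before \<open>n\<close>.\<close>
          assume "r < q"
          note h = accepted_history[OF r(1,3)]
          have "acc (en t r) < ver (en t q)"
            using ver_after_injury[OF h(1), of q] h(2) \<open>r < q\<close> f(5)[of t] step(1) by simp
          also have "\<dots> < n" using ver_bounds[of q t] f(5)[of t] step(1) unfolding n_def by simp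
          finally have "acc (en t r) < ?L" using L(1) by simp
          moreover have "?L < acc (en t r)"
            using bit level_ext unfolding bit_at_def by (meson less_le_trans)
          ultimately show ?thesis by simp
        next
          \<comment> \<open>The acceptance of \<open>q\<close> at stage \<open>a\<close> removed all
            larger strategies, so the length of \<open>r\<close> exceeds \<open>a\<close>, while the
            extension of \<open>q\<close> ends by \<open>a\<close>.\<close>
          assume "q < r"
          have "a < ver (en t r)" using ver_after_injury[of a t r] f(1) \<open>q < r\<close> r(1) step(1) by simp
          also have "\<dots> < ?L" using ver_bounds[OF r(1)] r(4) by linarith
          finally show ?thesis using La by simp
        qed
        then show "bit_at ?x ?L" using bit f(5)[of t] step(1) unfolding a_def n_def by simp
      next
        assume "bit_at ?x ?L"
        then show "new_bit ext ow (st t) (pa t)"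
          unfolding new_bit_def using f(5)[of t] step(1) q L(1) unfolding a_def n_def
          by (intro exI[of _ q]) auto
      qed
      show ?case
      proof (cases "blocked ow (st t) (pa t)")
        case True
        then show ?thesis using step.IH by (simp add: path_Suc)
      next
        case False
        then have p: "pa (Suc t) = pa t @ [of_bool (new_bit ext ow (st t) (pa t))]" by (simp add: path_Suc)
        show ?thesis
        proof (intro allI impI)
          fix i assume i: "i < length (pa (Suc t))" "n \<le> i" "i < level (ext a q (take n (pa (Suc t))))"
          then have "n \<le> ?L" by (simp add: p)
          then have e: "take n (pa (Suc t)) = take n (pa t)" by (simp add: p)
          show "(pa (Suc t) ! i \<noteq> 0) = bit_at (ext a q (take n (pa (Suc t)))) i"
          proof (cases "i = ?L")
            case True
            then show ?thesis using new i unfolding e by (simp add: p)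
          next
            case False
            then show ?thesis using step.IH i unfolding e by (simp add: p nth_append)
          qed
        qed
      qed
    qed
  }
qed

lemma path_set_extension:
  assumes q: "ow q" "acc (final q) \<noteq> 0"
  defines "a \<equiv> acc (final q)" and "n \<equiv> len (final q)"
  obtains p where "length p = n" and "\<And>i. i < n \<Longrightarrow> i \<in> path_set ext ow \<longleftrightarrow> p ! i \<noteq> 0"
    and "\<And>i. n \<le> i \<Longrightarrow> i < level (ext a q p) \<Longrightarrow> i \<in> path_set ext ow \<longleftrightarrow> bit_at (ext a q p) i"
proof -
  obtain s where s: "n < length (pa s)" using path_unbounded by blast
  let ?p = "take n (pa s)"
  obtain u where u: "level (ext a q ?p) < length (pa u)" using path_unbounded by blast
  define t where "t = max s u"
  obtain p' where p': "pa t = pa s @ p'" using path_take[of s t] by (auto simp: t_def)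
  obtain p'' where p'': "pa t = pa u @ p''" using path_take[of u t] by (auto simp: t_def)
  have e: "take n (pa t) = ?p" using s by (simp add: p')
  have ut: "length (pa u) \<le> length (pa t)" unfolding p'' by simp
  show ?thesis
  proof (rule that[of ?p])
    show "length ?p = n" using s by simp
    show "i \<in> path_set ext ow \<longleftrightarrow> ?p ! i \<noteq> 0" if "i < n" for i
      using path_set_iff[of i s] s that by simp
    show "i \<in> path_set ext ow \<longleftrightarrow> bit_at (ext a q ?p) i" if "n \<le> i" "i < level (ext a q ?p)" for i
      using path_follows[OF q, of t, folded a_def n_def, unfolded e] path_set_iff[of i t] that u ut by auto
  qed
qed

end

section \<open>The instance for a low c.e. set\<close>

definition hits :: "nat set \<Rightarrow> nat \<Rightarrow> nat \<Rightarrow> nat \<Rightarrow> bool" where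
  "hits S b e x \<longleftrightarrow> (\<exists>w<b. \<exists>y<b. T S w e x y)"

text \<open>At level \<open>k\<close> the requirement is to meet the set of strings enumerated by the program \<open>lft k\<close>,
  so that every program is treated at infinitely many levels.\<close>

definition bound_works :: "nat set \<Rightarrow> nat \<Rightarrow> nat \<Rightarrow> nat \<Rightarrow> bool" where
  "bound_works S q n b \<longleftrightarrow>
     (\<forall>s. length (str s) = n \<longrightarrow>
       (\<exists>x<b. n \<le> length (str x) \<and> (\<forall>i<n. bit_at x i \<longleftrightarrow> bit_at s i) \<and> hits S b (lft (level q)) x))"

definition enum_stage :: "nat \<Rightarrow> nat \<Rightarrow> nat set" where
  "enum_stage a t = {i. halts_before a i t}"

text \<open>The number of the program that runs \<open>p\<close> on the triple \<open>(p, q, v)\<close>.\<close>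

definition question :: "nat \<Rightarrow> nat \<Rightarrow> nat \<Rightarrow> nat" where
  "question p q v = 4 * pr p (code_number (const_code (tr p q v))) + 6"

definition guess :: "nat \<Rightarrow> nat \<Rightarrow> nat \<Rightarrow> nat \<Rightarrow> nat \<Rightarrow> bool" where
  "guess j p q v t \<longleftrightarrow> jump_guess j (question p q v) t"

abbreviation "bnd a \<equiv> construction.bound (enum_stage a) bound_works"
abbreviation "rdy a \<equiv> construction.ready (enum_stage a) bound_works"
abbreviation "stage a j p \<equiv> construction.st (enum_stage a) bound_works (guess j p)"

text \<open>The last disjunct is a default value that makes the minimum exist. The bits in
  \<open>p\<close> are numbers, as in the path.\<close>

definition extension :: "nat \<Rightarrow> nat \<Rightarrow> nat \<Rightarrow> nat list \<Rightarrow> nat" where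
  "extension a s q p = (LEAST x.
     (x < bnd a s q (length p) \<and> length p \<le> length (str x) \<and>
      (\<forall>i<length p. bit_at x i \<longleftrightarrow> entry p i \<noteq> 0) \<and>
      hits (enum_stage a s) (bnd a s q (length p)) (lft (level q)) x) \<or>
     x = bnd a s q (length p))"

subsection \<open>Computability of the construction\<close>

lemma dec_enum_stage [rec_intros]:
  assumes "recursive Y i" "recursive Y t"
  shows "decidable Y (\<lambda>u. i u \<in> enum_stage a (t u))"
  unfolding enum_stage_def mem_Collect_eq by (intro rec_intros assms)

lemma dec_hits:
  assumes "recursive Y t" "recursive Y b" "recursive Y e" "recursive Y x"
  shows "decidable Y (\<lambda>u. hits (enum_stage a (t u)) (b u) (e u) (x u))"
proof -
  have "decidable Y (\<lambda>z. rgt z \<in> enum_stage a (lft z))" by (intro rec_intros)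
  note 1 = dec_T[OF this]
  have "decidable Y (\<lambda>u. hits (enum_stage a (lft u)) (lft (rgt u)) (lft (rgt (rgt u))) (rgt (rgt (rgt u))))"
    unfolding hits_def by (intro rec_intros 1)
  moreover have "recursive Y (\<lambda>u. pr (t u) (pr (b u) (pr (e u) (x u))))"
    by (intro rec_intros assms)
  ultimately show ?thesis by (rule rec_comp[elim_format]) simp
qed

lemma dec_bound_works:
  assumes "recursive Y t" "recursive Y q" "recursive Y n" "recursive Y b"
  shows "decidable Y (\<lambda>u. bound_works (enum_stage a (t u)) (q u) (n u) (b u))"
proof -
  have bounded: "bound_works S q n b \<longleftrightarrow> (\<forall>s<2 ^ Suc n. length (str s) = n \<longrightarrow>
       (\<exists>x<b. n \<le> length (str x) \<and> (\<forall>i<n. bit_at x i \<longleftrightarrow> bit_at s i) \<and> hits S b (lft (level q)) x))"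
    for S q n b
    unfolding bound_works_def using string_number_less string_number_str by metis
  have "decidable Y (\<lambda>u. bound_works (enum_stage a (lft u)) (lft (rgt u)) (lft (rgt (rgt u))) (rgt (rgt (rgt u))))"
    unfolding bounded by (intro rec_intros dec_hits)
  moreover have "recursive Y (\<lambda>u. pr (t u) (pr (q u) (pr (n u) (b u))))"
    by (intro rec_intros assms)
  ultimately show ?thesis by (rule rec_comp[elim_format]) simp
qed

lemma rec_bound [rec_intros]:
  assumes "recursive Y t" "recursive Y q" "recursive Y n"
  shows "recursive Y (\<lambda>u. bnd a (t u) (q u) (n u))"
proof -
  have "recursive Y (\<lambda>u. bnd a (lft u) (lft (rgt u)) (rgt (rgt u)))"
    unfolding construction.bound_def by (intro rec_intros dec_bound_works) blast
  moreover have "recursive Y (\<lambda>u. pr (t u) (pr (q u) (n u)))"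
    by (intro rec_intros assms)
  ultimately show ?thesis by (rule rec_comp[elim_format]) simp
qed

lemma dec_active [rec_intros]:
  assumes "rrecursive Y l" "recursive Y q" shows "decidable Y (\<lambda>u. active (l u) (q u))"
proof -
  have "decidable Y (\<lambda>u. active (rev (list_decode (lft u))) (rgt u))"
    unfolding active_def by (intro rec_intros rrec_entry)
  moreover have "recursive Y (\<lambda>u. pr (list_encode (rev (l u))) (q u))"
    by (intro rec_intros assms)
  ultimately show ?thesis by (rule rec_comp[elim_format]) simp
qed

lemma dec_ready:
  assumes "recursive Y t" "rrecursive Y l" "recursive Y q"
  shows "decidable Y (\<lambda>u. rdy a (t u) (l u) (q u))"
proof -
  have "decidable Y (\<lambda>u. rdy a (lft u) (rev (list_decode (lft (rgt u)))) (rgt (rgt u)))"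
    unfolding construction.ready_def construction.has_bound_def
    by (intro rec_intros rrec_entry dec_bound_works)
  moreover have "recursive Y (\<lambda>u. pr (t u) (pr (list_encode (rev (l u))) (q u)))"
    by (intro rec_intros assms)
  ultimately show ?thesis by (rule rec_comp[elim_format]) simp
qed

lemma dec_guess:
  assumes "recursive Y p" "recursive Y q" "recursive Y v" "recursive Y t"
  shows "decidable Y (\<lambda>u. guess j (p u) (q u) (v u) (t u))"
  unfolding guess_def question_def by (intro rec_intros assms)

lemma dec_attention:
  assumes "recursive Y p" "recursive Y t" "rrecursive Y l" "recursive Y q"
  shows "decidable Y (\<lambda>u. construction.attention (enum_stage a) bound_works (guess j (p u)) (t u) (l u) (q u))"
proof -
  have "decidable Y (\<lambda>u. construction.attention (enum_stage a) bound_works (guess j (lft u)) (lft (rgt u))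
      (rev (list_decode (lft (rgt (rgt u))))) (rgt (rgt (rgt u))))"
    unfolding construction.attention_def
    by (intro rec_intros rrec_entry dec_ready dec_guess)
  moreover have "recursive Y (\<lambda>u. pr (p u) (pr (t u) (pr (list_encode (rev (l u))) (q u))))"
    by (intro rec_intros assms)
  ultimately show ?thesis by (rule rec_comp[elim_format]) simp
qed

lemma rec_actor:
  assumes "recursive Y p" "recursive Y t" "rrecursive Y l"
  shows "recursive Y (\<lambda>u. construction.actor (enum_stage a) bound_works (guess j (p u)) (t u) (l u))"
proof -
  have "recursive Y (\<lambda>u. construction.actor (enum_stage a) bound_works (guess j (lft u)) (lft (rgt u))
      (rev (list_decode (rgt (rgt u)))))"
    unfolding construction.actor_def
    by (intro rec_Least dec_disj dec_attention dec_eq rrec_length rec_intros) blast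
  moreover have "recursive Y (\<lambda>u. pr (p u) (pr (t u) (list_encode (rev (l u)))))"
    by (intro rec_intros assms)
  ultimately show ?thesis by (rule rec_comp[elim_format]) simp
qed

lemma rec_new_entry:
  assumes "recursive Y t" "rrecursive Y l" "recursive Y q"
  shows "recursive Y (\<lambda>u. construction.new_entry (t u) (l u) (q u))"
proof -
  have "recursive Y (\<lambda>u. construction.new_entry (lft u) (rev (list_decode (lft (rgt u)))) (rgt (rgt u)))"
    unfolding construction.new_entry_def
    by (intro rec_if dec_eq rrec_length rec_pr rec_lft rec_rgt rrec_entry rec_Suc rec_const rrec_decode rec_id)
  moreover have "recursive Y (\<lambda>u. pr (t u) (pr (list_encode (rev (l u))) (q u)))"
    by (intro rec_intros assms)
  ultimately show ?thesis by (rule rec_comp[elim_format]) simp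
qed

text \<open>The parameter \<open>p\<close> is an input here, so one program can simulate the
  constructions for all \<open>p\<close>.\<close>

lemma rec_st [rec_intros]:
  assumes "recursive Y p" "recursive Y t"
  shows "rrecursive Y (\<lambda>u. stage a j (p u) (t u))"
proof -
  have 1: "recursive Y (\<lambda>z. p (lft z))" by (rule rec_comp[OF assms(1)]) (intro rec_intros)
  show ?thesis
    unfolding construction.st_def
    by (intro rrec_primrec rrec_Nil rrec_snoc rrec_take rec_new_entry rec_actor 1 assms rec_intros)
qed

text \<open>\<open>z\<close> packs a triple \<open>(p, q, v)\<close> and a stage; the oracle is
  queried only to test whether the approximation is correct.\<close>

lemma dec_true_proposal:
  assumes a: "A = {i. \<exists>t. halts_before a i t}"
  shows "decidable A (\<lambda>z. lft (rgt (lft z)) < length (stage a j (lft (lft z)) (rgt z)) \<and>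
    ver (entry (stage a j (lft (lft z)) (rgt z)) (lft (rgt (lft z)))) = rgt (rgt (lft z)) \<and>
    rdy a (rgt z) (stage a j (lft (lft z)) (rgt z)) (lft (rgt (lft z))) \<and>
    (\<forall>i<bnd a (rgt z) (lft (rgt (lft z))) (len (entry (stage a j (lft (lft z)) (rgt z)) (lft (rgt (lft z))))).
      i \<in> enum_stage a (rgt z) \<longleftrightarrow> i \<in> A))"
  by (intro dec_conj dec_less dec_eq dec_all_less dec_iff dec_ready rec_bound rrec_length rrec_entry
      dec_enum_stage dec_oracle rec_st rec_lft rec_rgt rec_id)

lemma code_number_in_jump:
  "code_number c \<in> turing_jump A \<longleftrightarrow> (\<exists>y. computes A c (code_number c) y)"
  unfolding turing_jump_def by (auto simp: code_number_eq_iff)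

text \<open>The recursion theorem is not needed: the construction has a parameter \<open>p\<close>, and the search
  for a true proposal of the construction with parameter \<open>p\<close> is uniform in \<open>p\<close>.\<close>

lemma ex_parameter:
  assumes ce: "ce A" and low: "low A"
  obtains a j p where "lowness_construction (enum_stage a) bound_works (guess j p) A"
proof -
  obtain ca where ca: "A = {i. \<exists>y. computes {} ca i y}" using ce unfolding ce_relative_def by blast
  define a where "a = code_number ca"
  have a: "A = {i. \<exists>t. halts_before a i t}" unfolding ca a_def ex_halts_before ..
  obtain cj where cj: "\<And>x. computes (turing_jump {}) cj x (of_bool (x \<in> turing_jump A))"
    using low unfolding low_def turing_equivalent_def turing_reducible_def of_bool_def by blast
  define j where "j = code_number cj"
  obtain d where d: "\<And>x. (\<exists>y. computes A d x y) \<longleftrightarrow>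
      (\<exists>u. lft (rgt x) < length (stage a j (lft x) u) \<and>
        ver (entry (stage a j (lft x) u) (lft (rgt x))) = rgt (rgt x) \<and>
        rdy a u (stage a j (lft x) u) (lft (rgt x)) \<and>
        (\<forall>i<bnd a u (lft (rgt x)) (len (entry (stage a j (lft x) u) (lft (rgt x)))).
          i \<in> enum_stage a u \<longleftrightarrow> i \<in> A))"
    using ex_domain_code[OF dec_true_proposal[OF a, of j]] by blast
  \<comment> \<open>\<open>d\<close> searches for a true proposal of version \<open>v\<close> of
    \<open>q\<close> in the construction whose parameter is part of its input; choosing its own
    number as the parameter closes the circle.\<close>
  define p where "p = code_number d"
  have question: "question p q v \<in> turing_jump A \<longleftrightarrow> (\<exists>y. computes A d (tr p q v) y)" for q v
  proof -
    have "question p q v = code_number (Comp d (const_code (tr p q v)))"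
      by (simp add: question_def p_def)
    then have "question p q v \<in> turing_jump A \<longleftrightarrow>
        (\<exists>y. computes A (Comp d (const_code (tr p q v))) (question p q v) y)"
      by (simp only: code_number_in_jump)
    then show ?thesis unfolding ex_computes_Comp_const .
  qed
  have "lowness_construction (enum_stage a) bound_works (guess j p) A"
  proof
    show "enum_stage a s \<subseteq> enum_stage a t" if "s \<le> t" for s t
      unfolding enum_stage_def using halts_before_mono that by blast
    show "(\<Union>t. enum_stage a t) = A" unfolding enum_stage_def a by blast
    show "bound_works S q n b = bound_works S' q n b"
      if "\<And>i. i < b \<Longrightarrow> i \<in> S \<longleftrightarrow> i \<in> S'" for S S' q n b
    proof -
      have "hits S b e x = hits S' b e x" for e x
        unfolding hits_def using T_cong[of _ S S'] that by (meson order_less_trans)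
      then show ?thesis unfolding bound_works_def by simp
    qed
    show "\<exists>s. \<forall>t\<ge>s. guess j p q v t \<longleftrightarrow> (\<exists>u. q < length (stage a j p u) \<and>
        ver (entry (stage a j p u) q) = v \<and> rdy a u (stage a j p u) q \<and>
        (\<forall>i<bnd a u q (len (entry (stage a j p u) q)). i \<in> enum_stage a u \<longleftrightarrow> i \<in> A))" for q v
      using jump_guess_limit[OF cj, of "question p q v"] d[of "tr p q v"]
      unfolding guess_def question j_def by simp
  qed
  then show ?thesis by (rule that)
qed

subsection \<open>Computability of the set obtained from an oracle\<close>

text \<open>Exactly one string of each level from \<open>c\<close> on is owned.\<close>

definition owns :: "nat \<Rightarrow> nat set \<Rightarrow> nat \<Rightarrow> bool" where
  "owns c Y q \<longleftrightarrow> c \<le> level q \<and> (\<forall>i<level q. bit_at q i \<longleftrightarrow> pr (level q) i \<in> Y)"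

lemma dec_owns:
  assumes "recursive Y q" shows "decidable Y (\<lambda>u. owns c Y (q u))"
proof -
  have "decidable Y (owns c Y)"
    unfolding owns_def by (intro rec_intros dec_oracle)
  from rec_comp[OF this assms] show ?thesis .
qed

lemma rec_extension:
  assumes "recursive Y s" "recursive Y q" "rrecursive Y p"
  shows "recursive Y (\<lambda>u. extension a (s u) (q u) (p u))"
proof -
  have "recursive Y (\<lambda>u. extension a (lft u) (lft (rgt u)) (rev (list_decode (rgt (rgt u)))))"
    unfolding extension_def
    by (intro rec_Least dec_disj dec_conj dec_less dec_le dec_eq dec_all_less dec_iff dec_not dec_bit_at
        dec_hits rec_bound rrec_length rrec_entry rec_length_str dec_enum_stage rec_lft rec_rgt
        rrec_decode rec_const rec_id) blast
  moreover have "recursive Y (\<lambda>u. pr (s u) (pr (q u) (list_encode (rev (p u)))))"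
    by (intro rec_intros assms)
  ultimately show ?thesis by (rule rec_comp[elim_format]) simp
qed

abbreviation "path_stage a j p c Y \<equiv>
  construction.path (enum_stage a) bound_works (guess j p) (extension a) (owns c Y)"

lemma rec_path:
  assumes "recursive Y t"
  shows "rrecursive Y (\<lambda>u. path_stage a j p c Y (t u))"
proof -
  have 1: "decidable Y (\<lambda>z. construction.blocked (owns c Y) (stage a j p (lft (rgt z)))
      (rev (list_decode (rgt (rgt z)))))"
    unfolding construction.blocked_def
    by (intro dec_ex_less dec_conj dec_eq dec_le dec_owns dec_active rrec_entry rrec_length rec_st
        rrec_decode rec_const rec_lft rec_rgt rec_id)
  have 2: "decidable Y (\<lambda>z. construction.new_bit (extension a) (owns c Y) (stage a j p (lft (rgt z)))
      (rev (list_decode (rgt (rgt z)))))"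
    unfolding construction.new_bit_def
    by (intro dec_ex_less dec_conj dec_eq dec_le dec_not dec_owns dec_bit_at rec_extension rrec_take
        rrec_entry rrec_length rec_st rrec_decode rec_const rec_lft rec_rgt rec_id)
  show ?thesis
    unfolding construction.path_def
    by (intro rrec_primrec rrec_Nil rrec_if rrec_snoc 1 2 assms rrec_decode rec_rgt rec_id)
qed

text \<open>As the path is unbounded, bit \<open>i\<close> can be read at the first stage where the
  path is longer than \<open>i\<close>.\<close>

lemma path_set_reducible:
  assumes "path_construction (enum_stage a) bound_works (guess j p) A (extension a) (owns c Y)"
  shows "construction.path_set (enum_stage a) bound_works (guess j p) (extension a) (owns c Y) \<le>\<^sub>T Y"
proof -
  interpret path_construction "enum_stage a" bound_works "guess j p" A "extension a" "owns c Y"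
    by (rule assms)
  have 0: "recursive Y (\<lambda>i. LEAST t. i < length (path_stage a j p c Y t))"
    by (intro rec_Least dec_less rrec_length rec_path rec_lft rec_rgt rec_id path_unbounded)
  have "decidable Y (\<lambda>i. entry (path_stage a j p c Y (LEAST t. i < length (path_stage a j p c Y t))) i \<noteq> 0)"
    by (intro dec_not dec_eq rrec_entry rec_path 0 rec_id rec_const)
  moreover have "entry (path_stage a j p c Y (LEAST t. i < length (path_stage a j p c Y t))) i \<noteq> 0 \<longleftrightarrow>
      i \<in> path_set (extension a) (owns c Y)" for i
  proof -
    have "i < length (path_stage a j p c Y (LEAST t. i < length (path_stage a j p c Y t)))"
      by (rule LeastI_ex) (rule path_unbounded)
    from path_set_iff[OF this] this show ?thesis unfolding entry_def by simp
  qed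
  ultimately show ?thesis unfolding turing_reducible_iff by simp
qed

lemma computes_generic:
  assumes low: "lowness_construction (enum_stage a) bound_works (guess j p) A"
    and not_stuck: "\<And>q. owns c Y q \<Longrightarrow>
      \<not> lowness_construction.stuck (enum_stage a) bound_works (guess j p) q"
  shows "\<exists>G. G \<le>\<^sub>T Y \<and> weakly_1_generic A G"
proof -
  interpret lowness_construction "enum_stage a" bound_works "guess j p" A by (rule low)
  have bound_le: "bnd a s q n \<le> s" for s q n
    unfolding bound_def by (rule Least_le) simp
  have pc: "path_construction (enum_stage a) bound_works (guess j p) A (extension a) (owns c Y)"
  proof
    show "length (str (extension a s q r)) \<le> s" for s q r
    proof -
      have "extension a s q r \<le> bnd a s q (length r)"
        unfolding extension_def by (rule Least_le) simp
      then show ?thesis using length_str_le[of "extension a s q r"] bound_le[of s q "length r"] by linarith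
    qed
  qed (rule not_stuck)
  interpret path_construction "enum_stage a" bound_works "guess j p" A "extension a" "owns c Y"
    by (rule pc)
  let ?G = "path_set (extension a) (owns c Y)"
  have "weakly_1_generic A ?G"
    unfolding weakly_1_generic_def
  proof (intro allI impI, elim conjE)
    fix D assume dense: "dense_strings D" and D: "ce_relative A (string_number ` D)"
    obtain d where d: "string_number ` D = {x. \<exists>y. computes A d x y}"
      using D unfolding ce_relative_def by blast
    define e where "e = code_number d"
    have D_iff: "str x \<in> D \<longleftrightarrow> (\<exists>b. hits A b e x)" for x
    proof -
      have "str x \<in> D \<longleftrightarrow> x \<in> string_number ` D"
        by (metis imageE image_eqI str_string_number string_number_str)
      also have "\<dots> \<longleftrightarrow> (\<exists>y w. T A w e x y)" unfolding d e_def computes_iff_T by blast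
      also have "\<dots> \<longleftrightarrow> (\<exists>b. hits A b e x)"
        unfolding hits_def by (meson less_Suc_eq_le max.cobounded1 max.cobounded2)
      finally show ?thesis .
    qed
    \<comment> \<open>This level serves the program \<open>e\<close>, since
      \<open>lft k = e\<close>, and one of its strategies is owned, since
      \<open>c \<le> k\<close>.\<close>
    define k where "k = pr e c"
    define q where "q = string_number (map (\<lambda>i. pr k i \<in> Y) [0..<k])"
    have q: "level q = k" "owns c Y q"
      using le_prod_encode_2[of c e] by (auto simp: q_def owns_def bit_at_def k_def)
    \<comment> \<open>All strategies of the level are considered, since a waiting \<open>q\<close>
      only yields some stuck strategy of its level. Density gives a bound for each string of length
      \<open>n\<close>, and the maximum over these finitely many strings suffices.\<close>
    have works: "\<exists>b. bound_works A r n b" if r: "level r = k" for r n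
    proof -
      have "\<exists>b. \<exists>x<b. n \<le> length (str x) \<and> (\<forall>i<n. bit_at x i \<longleftrightarrow> bit_at s i) \<and> hits A b e x"
        if s: "length (str s) = n" for s
      proof -
        obtain t where t: "t \<in> D" "prefix (str s) t" using dense unfolding dense_strings_def by blast
        obtain b where b: "hits A b e (string_number t)" using D_iff[of "string_number t"] t by auto
        obtain t' where t': "t = str s @ t'" using t(2) by (auto elim: prefixE)
        have "hits A (max b (Suc (string_number t))) e (string_number t)"
          using b unfolding hits_def by (meson less_max_iff_disj)
        then show ?thesis using s
          by (intro exI[of _ "max b (Suc (string_number t))"] exI[of _ "string_number t"])
            (auto simp: t' bit_at_def nth_append)
      qed
      then obtain B where B: "\<And>s. length (str s) = n \<Longrightarrow>
          \<exists>x<B s. n \<le> length (str x) \<and> (\<forall>i<n. bit_at x i \<longleftrightarrow> bit_at s i) \<and> hits A (B s) e x"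
        by metis
      define b where "b = Max (B ` {..<2 ^ Suc n})"
      have Bb: "B s \<le> b" if "length (str s) = n" for s
        using string_number_less[of "str s"] that unfolding b_def by (intro Max_ge) auto
      have "\<exists>x<b. n \<le> length (str x) \<and> (\<forall>i<n. bit_at x i \<longleftrightarrow> bit_at s i) \<and> hits A b e x"
        if s: "length (str s) = n" for s
      proof -
        have "hits A (B s) e x \<Longrightarrow> hits A b e x" for x
          using Bb[OF s] unfolding hits_def by (meson order_less_le_trans)
        then show ?thesis using B[OF s] Bb[OF s] by (meson order_less_le_trans)
      qed
      then have "bound_works A r n b"
        unfolding bound_works_def r by (simp add: k_def)
      then show ?thesis by blast
    qed
    have acc: "acc (final q) \<noteq> 0"
      using not_accepted_imp_stuck[of q] stuck_imp_no_bound works q(1) by metis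
    define s where "s = acc (final q)"
    define n where "n = len (final q)"
    define b where "b = bnd a s q n"
    note f = final_accepted[OF acc, folded s_def n_def, folded b_def]
    obtain r where r: "length r = n" "\<And>i. i < n \<Longrightarrow> i \<in> ?G \<longleftrightarrow> r ! i \<noteq> 0"
      "\<And>i. n \<le> i \<Longrightarrow> i < level (extension a s q r) \<Longrightarrow> i \<in> ?G \<longleftrightarrow> bit_at (extension a s q r) i"
      using path_set_extension[OF q(2) acc, folded s_def n_def] by blast
    define good where "good x \<longleftrightarrow> x < b \<and> n \<le> length (str x) \<and>
      (\<forall>i<n. bit_at x i \<longleftrightarrow> entry r i \<noteq> 0) \<and> hits (enum_stage a s) b e x" for x
    have ext: "extension a s q r = (LEAST x. good x \<or> x = b)"
      unfolding extension_def good_def r(1) b_def q(1) k_def by simp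
    \<comment> \<open>Such computations query the oracle only below \<open>b\<close>, where stage
      \<open>s\<close> is already correct.\<close>
    have hits_eq: "hits (enum_stage a s) b e x = hits A b e x" for x
      unfolding hits_def using T_cong[of _ "enum_stage a s" A] f(8) by (meson order_less_trans)
    define w where "w = string_number (map (\<lambda>x. x \<noteq> 0) r)"
    have w_bits: "bit_at w i \<longleftrightarrow> r ! i \<noteq> 0" if "i < n" for i
      using that by (simp add: bit_at_def w_def r(1))
    have "length (str w) = n" by (simp add: w_def r(1))
    then obtain x where x: "x < b" "n \<le> length (str x)" "\<forall>i<n. bit_at x i \<longleftrightarrow> bit_at w i" "hits A b e x"
      using f(6) unfolding bound_works_def q(1) by (auto simp: k_def)
    have "good x"
      unfolding good_def hits_eq using x w_bits by (simp add: entry_def r(1))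
    moreover have "good (extension a s q r) \<or> extension a s q r = b"
      unfolding ext by (rule LeastI[of _ b]) simp
    \<comment> \<open>The true extension \<open>x\<close> lies below \<open>b\<close>, so the
      minimum is not the default value \<open>b\<close>.\<close>
    moreover have "extension a s q r \<le> x" unfolding ext by (rule Least_le) (simp add: \<open>good x\<close>)
    ultimately have g: "good (extension a s q r)" using x(1) by auto
    let ?x = "extension a s q r"
    have "str ?x \<in> D" using g D_iff unfolding good_def hits_eq by blast
    moreover have "str ?x ! i \<longleftrightarrow> i \<in> ?G" if "i < length (str ?x)" for i
    proof (cases "i < n")
      case True
      then show ?thesis using g r(1,2) that unfolding good_def bit_at_def entry_def by auto
    next
      case False
      then show ?thesis using r(3)[of i] that unfolding bit_at_def by auto
    qed
    then have "initial_segment (str ?x) ?G"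
      unfolding initial_segment_def by (intro nth_equalityI) auto
    ultimately show "\<exists>s\<in>D. initial_segment s ?G" by blast
  qed
  then show ?thesis using path_set_reducible[OF pc] by blast
qed

section \<open>Cylinders in Cantor space\<close>

lemma prob_space_cantor: "prob_space cantor_measure"
  unfolding cantor_measure_def by (intro prob_space_PiM measure_pmf.prob_space_axioms)

lemma space_cantor [simp]: "space cantor_measure = UNIV"
  by (simp add: cantor_measure_def space_PiM)

lemma
  assumes "finite J"
  shows cylinder_sets: "{x. \<forall>j\<in>J. x j = f j} \<in> sets cantor_measure"
    and measure_cylinder: "measure cantor_measure {x. \<forall>j\<in>J. x j = f j} = (1 / 2) ^ card J"
proof -
  interpret product_prob_space "\<lambda>_. measure_pmf (bernoulli_pmf (1 / 2))" "UNIV :: nat set"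
    by unfold_locales
  have eq: "{x. \<forall>j\<in>J. x j = f j} =
      prod_emb UNIV (\<lambda>_. measure_pmf (bernoulli_pmf (1 / 2))) J (Pi\<^sub>E J (\<lambda>j. {f j}))"
    by (rule set_eqI) (simp only: prod_emb_iff restrict_PiE_iff extensional_UNIV, simp)
  show "{x. \<forall>j\<in>J. x j = f j} \<in> sets cantor_measure"
    unfolding eq cantor_measure_def using assms by (intro sets_PiM_I) auto
  show "measure cantor_measure {x. \<forall>j\<in>J. x j = f j} = (1 / 2) ^ card J"
    unfolding eq cantor_measure_def using assms
    by (subst measure_PiM_emb) (auto simp: measure_pmf_single pmf_bernoulli_half)
qed

text \<open>By uniqueness the bad event at length \<open>k\<close> is empty or a cylinder on
  \<open>k\<close> coordinates; its measure is at most 2^-k, and the sum converges.\<close>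

lemma AE_avoids_cylinders:
  fixes Q :: "nat \<Rightarrow> bool list \<Rightarrow> bool"
  assumes unique: "\<And>k s t. Q k s \<Longrightarrow> Q k t \<Longrightarrow> length s = k \<Longrightarrow> length t = k \<Longrightarrow> s = t"
  shows "AE x in cantor_measure. \<exists>c. \<forall>k\<ge>c. \<forall>s. length s = k \<and> Q k s \<longrightarrow> s \<noteq> map (\<lambda>i. x (pr k i)) [0..<k]"
proof -
  interpret prob_space cantor_measure by (rule prob_space_cantor)
  define B where "B k = {x. \<exists>s. length s = k \<and> Q k s \<and> s = map (\<lambda>i. x (pr k i)) [0..<k]}" for k
  have B: "B k \<in> sets cantor_measure \<and> measure cantor_measure (B k) \<le> (1 / 2) ^ k" for k
  proof (cases "\<exists>s. length s = k \<and> Q k s")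
    case True
    then obtain s where s: "length s = k" "Q k s" by blast
    have inj: "inj_on (pr k) {..<k}" by (auto simp: inj_on_def)
    define f where "f j = s ! rgt j" for j
    have "B k = {x. \<forall>j\<in>pr k ` {..<k}. x j = f j}"
    proof -
      have "B k = {x. s = map (\<lambda>i. x (pr k i)) [0..<k]}"
        unfolding B_def using s unique by blast
      also have "\<dots> = {x. \<forall>j\<in>pr k ` {..<k}. x j = f j}"
        by (auto simp: f_def list_eq_iff_nth_eq s)
      finally show ?thesis .
    qed
    then show ?thesis
      using cylinder_sets[of "pr k ` {..<k}" f] measure_cylinder[of "pr k ` {..<k}" f]
      by (simp add: card_image[OF inj])
  next
    case False
    then have "B k = {}" unfolding B_def by blast
    then show ?thesis by simp
  qed
  have "AE x in cantor_measure. eventually (\<lambda>k. x \<in> space cantor_measure - B k) sequentially"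
  proof (rule borel_cantelli_AE1)
    show "summable (\<lambda>k. measure cantor_measure (B k))"
      by (rule summable_comparison_test'[of "\<lambda>k. (1 / 2 :: real) ^ k" 0]) (use B in auto)
  qed (use B in \<open>auto simp: emeasure_eq_measure\<close>)
  then show ?thesis
    by (rule AE_mp) (rule AE_I2, auto simp: B_def eventually_sequentially)
qed

section \<open>Generic sets are far from all sets computable in the oracle\<close>

lemma ce_relative_decidable:
  assumes "decidable X P" shows "ce_relative X {n. P n}"
proof -
  have "decidable X (\<lambda>z. P (lft z))"
    by (rule rec_comp[OF assms]) (intro rec_intros)
  from ex_domain_code[OF this] obtain c where "\<And>x. (\<exists>y. computes X c x y) \<longleftrightarrow> (\<exists>n::nat. P x)"
    by blast
  then show ?thesis unfolding ce_relative_def by auto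
qed

text \<open>The strings longer than \<open>k\<close> that disagree with \<open>X\<close> on at least
  k/(k+1) of their positions form a dense set decidable in \<open>A\<close>.\<close>

lemma generic_disagreement:
  assumes G: "weakly_1_generic A G" and X: "X \<le>\<^sub>T A"
  shows "\<exists>n>k. k * n \<le> Suc k * card (sym_diff G X \<inter> {0..<n})"
proof -
  define cnt where "cnt s = card {i. i < length s \<and> s ! i \<noteq> (i \<in> X)}" for s :: "bool list"
  define D where "D = {s. k < length s \<and> k * length s \<le> Suc k * cnt s}"
  have Xd: "decidable A (\<lambda>n. n \<in> X)" using X unfolding turing_reducible_iff .
  have "decidable A (\<lambda>n. k < length (str n) \<and> k * length (str n) \<le>
      Suc k * rec_nat 0 (\<lambda>i r. r + of_bool (\<not> (bit_at n i \<longleftrightarrow> i \<in> X))) (length (str n)))"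
    by (intro rec_intros rec_comp[OF Xd])
  moreover have "rec_nat 0 (\<lambda>i r. r + of_bool (\<not> (bit_at n i \<longleftrightarrow> i \<in> X))) (length (str n)) = cnt (str n)" for n
  proof -
    have "rec_nat 0 (\<lambda>i r. r + of_bool (\<not> (bit_at n i \<longleftrightarrow> i \<in> X))) m =
        card {i. i < m \<and> \<not> (bit_at n i \<longleftrightarrow> i \<in> X)}" for m
    proof (induction m)
      case (Suc m)
      have "{i. i < Suc m \<and> \<not> (bit_at n i \<longleftrightarrow> i \<in> X)} =
          (if bit_at n m \<longleftrightarrow> m \<in> X then {} else {m}) \<union> {i. i < m \<and> \<not> (bit_at n i \<longleftrightarrow> i \<in> X)}"
        by (auto simp: less_Suc_eq)
      then show ?case using Suc by simp
    qed simp
    moreover have "{i. i < length (str n) \<and> \<not> (bit_at n i \<longleftrightarrow> i \<in> X)} =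
        {i. i < length (str n) \<and> str n ! i \<noteq> (i \<in> X)}"
      by (auto simp: bit_at_def)
    ultimately show ?thesis unfolding cnt_def by simp
  qed
  ultimately have "decidable A (\<lambda>n. str n \<in> D)" unfolding D_def by simp
  then have "ce_relative A {n. str n \<in> D}" by (rule ce_relative_decidable)
  moreover have "{n. str n \<in> D} = string_number ` D"
    using string_number_str by (force simp: image_iff)
  moreover have "dense_strings D"
    unfolding dense_strings_def
  proof
    fix s :: "bool list"
    \<comment> \<open>This length makes the old part \<open>s\<close> at most a fraction 1/(k+1) of
      \<open>t\<close>, and the rest of \<open>t\<close> disagrees with \<open>X\<close>
      everywhere.\<close>
    define m where "m = Suc k * Suc (length s)"
    define t where "t = s @ map (\<lambda>i. i \<notin> X) [length s..<m]"
    have m: "length s \<le> m" "k < m" by (simp_all add: m_def)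
    then have len: "length t = m" by (simp add: t_def)
    have "{length s..<m} \<subseteq> {i. i < length t \<and> t ! i \<noteq> (i \<in> X)}"
      by (auto simp: len) (auto simp: t_def nth_append)
    then have "m - length s \<le> cnt t"
      unfolding cnt_def by (metis card_mono card_atLeastLessThan finite_Collect_conjI finite_Collect_less_nat)
    then have "Suc k * (m - length s) \<le> Suc k * cnt t" by (rule mult_le_mono2)
    moreover have "k * m \<le> Suc k * (m - length s)"
      by (simp add: m_def algebra_simps diff_mult_distrib2)
    ultimately have "t \<in> D" unfolding D_def using m len by simp
    moreover have "prefix s t" by (simp add: t_def)
    ultimately show "\<exists>t\<in>D. prefix s t" by blast
  qed
  ultimately obtain s where s: "s \<in> D" "initial_segment s G"
    using G unfolding weakly_1_generic_def by auto
  have "s ! i \<longleftrightarrow> i \<in> G" if "i < length s" for i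
    using arg_cong[OF s(2)[unfolded initial_segment_def], of "\<lambda>l. l ! i"] that by simp
  then have "{i. i < length s \<and> s ! i \<noteq> (i \<in> X)} = sym_diff G X \<inter> {0..<length s}"
    by auto
  then show ?thesis using s(1) unfolding D_def cnt_def by auto
qed

lemma upper_density_generic:
  assumes "weakly_1_generic A G" and "X \<le>\<^sub>T A"
  shows "1 \<le> upper_density (sym_diff G X)"
proof (rule ccontr)
  let ?d = "\<lambda>n. initial_density n (sym_diff G X)"
  assume "\<not> ?thesis"
  then have "upper_density (sym_diff G X) < 1" by simp
  from Rats_dense_in_real[OF this] obtain r where r: "upper_density (sym_diff G X) < r" "r < 1" by blast
  have "limsup (\<lambda>n. ereal (?d n)) < ereal r"
    unfolding ereal_upper_density[symmetric] using r(1) by simp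
  from Limsup_lessD[OF this] obtain m where m: "\<And>n. m \<le> n \<Longrightarrow> ?d n < r"
    unfolding eventually_sequentially by auto
  obtain l where l: "r < 1 - inverse (real (Suc l))"
    using reals_Archimedean[of "1 - r"] r(2) by (auto simp: algebra_simps)
  \<comment> \<open>\<open>l\<close> brings the ratio k/(k+1) above \<open>r\<close>, and
    \<open>m\<close> puts \<open>n\<close> in the range where the density stays below
    \<open>r\<close>.\<close>
  define k where "k = max l m"
  obtain n where n: "k < n" "k * n \<le> Suc k * card (sym_diff G X \<inter> {0..<n})"
    using generic_disagreement[OF assms] by blast
  have "real k * real n \<le> real (Suc k) * real (card (sym_diff G X \<inter> {0..<n}))"
    using n(2) by (metis of_nat_mult of_nat_mono)
  then have "real k / real (Suc k) \<le> ?d n"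
    using n(1) unfolding initial_density_def by (simp add: field_simps)
  moreover have "1 - inverse (real (Suc l)) \<le> real k / real (Suc k)"
    by (simp add: k_def field_simps)
  moreover have "?d n < r" by (rule m) (use n(1) in \<open>simp add: k_def\<close>)
  ultimately show False using l by linarith
qed

lemma upper_density_le_1: "upper_density X \<le> 1"
proof -
  have "limsup (\<lambda>n. ereal (initial_density n X)) \<le> 1"
    by (rule Limsup_bounded) (simp add: initial_density_le_1)
  then show ?thesis unfolding ereal_upper_density[symmetric] by simp
qed

text \<open>The class of \<open>G\<close> is at distance at least 1 from every class computable in
  \<open>A\<close>, and this closed condition passes to the closure.\<close>

lemma coarse_distance_generic:
  assumes G: "weakly_1_generic A G" and GB: "G \<le>\<^sub>T B"
  shows "1 \<le> coarse_distance A B"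
proof -
  let ?S = "closure (computable_classes A)" and ?T = "closure (computable_classes B)"
  let ?x = "coarse_class G"
  \<comment> \<open>Provides a point of the closure; over an empty set \<open>infdist\<close> would
    be 0.\<close>
  have "{} \<le>\<^sub>T A" unfolding turing_reducible_iff using rec_const[of A 0] by simp
  then have ne: "coarse_class {} \<in> ?S" unfolding computable_classes_def using closure_subset by fastforce
  have "computable_classes A \<subseteq> {y. 1 \<le> dist ?x y}"
    unfolding computable_classes_def using upper_density_generic[OF G]
    by (auto simp: dist_coarse_class.abs_eq)
  moreover have "closed {y. 1 \<le> dist ?x y}" by (intro closed_Collect_le continuous_intros)
  ultimately have "?S \<subseteq> {y. 1 \<le> dist ?x y}" by (rule closure_minimal)
  then have "1 \<le> infdist ?x ?S"
    using ne by (subst infdist_notempty) (auto intro!: cINF_greatest)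
  also have "\<dots> \<le> (SUP y\<in>?T. infdist y ?S)"
  proof (rule cSUP_upper)
    show "?x \<in> ?T" unfolding computable_classes_def using GB closure_subset by fastforce
    have "dist y z \<le> 1" for y z :: coarse_class
      by transfer (rule upper_density_le_1)
    then have "infdist y ?S \<le> 1" for y
      using infdist_le[OF ne, of y] order_trans by blast
    then show "bdd_above ((\<lambda>y. infdist y ?S) ` ?T)" by (intro bdd_aboveI[of _ 1]) auto
  qed
  finally show ?thesis unfolding coarse_distance_def hausdorff_distance_def by simp
qed

theorem theorem5p15:
  fixes A :: "nat set"
  assumes "ce A" and "low A"
  shows "(AE x in cantor_measure. \<exists>G. G \<le>\<^sub>T Collect x \<and> weakly_1_generic A G) \<and> dispersive A"
proof
  obtain a j p where low: "lowness_construction (enum_stage a) bound_works (guess j p) A"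
    using ex_parameter assms by blast
  then interpret lowness_construction "enum_stage a" bound_works "guess j p" A .
  \<comment> \<open>Strategies are strings, and each length has at most one stuck string.\<close>
  have "AE x in cantor_measure. \<exists>c. \<forall>k\<ge>c. \<forall>s. length s = k \<and> stuck (string_number s) \<longrightarrow>
      s \<noteq> map (\<lambda>i. x (pr k i)) [0..<k]"
  proof (rule AE_avoids_cylinders)
    show "s = t" if "stuck (string_number s)" "stuck (string_number t)" "length s = k" "length t = k" for k s t
      using stuck_unique[OF that(1,2)] that(3,4) by (metis str_string_number)
  qed
  then show generic: "AE x in cantor_measure. \<exists>G. G \<le>\<^sub>T Collect x \<and> weakly_1_generic A G"
  proof (rule AE_mp, intro AE_I2 impI)
    fix x
    assume "\<exists>c. \<forall>k\<ge>c. \<forall>s. length s = k \<and> stuck (string_number s) \<longrightarrow> s \<noteq> map (\<lambda>i. x (pr k i)) [0..<k]"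
    then obtain c where c: "\<And>s. c \<le> length s \<Longrightarrow> stuck (string_number s) \<Longrightarrow>
        s \<noteq> map (\<lambda>i. x (pr (length s) i)) [0..<length s]" by blast
    have "\<not> stuck q" if "owns c (Collect x) q" for q
    proof
      assume "stuck q"
      then have "str q \<noteq> map (\<lambda>i. x (pr (level q) i)) [0..<level q]"
        using c[of "str q"] that unfolding owns_def by simp
      moreover have "str q = map (\<lambda>i. x (pr (level q) i)) [0..<level q]"
        using that unfolding owns_def bit_at_def by (intro nth_equalityI) auto
      ultimately show False by blast
    qed
    then show "\<exists>G. G \<le>\<^sub>T Collect x \<and> weakly_1_generic A G"
      by (rule computes_generic[OF low])
  qed
  show "dispersive A"
    unfolding dispersive_def
  proof
    \<comment> \<open>Almost every \<open>x\<close> would have distance both equal to 1/2 and at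
      least 1.\<close>
    assume "AE x in cantor_measure. coarse_distance A (Collect x) = 1 / 2"
    with generic have "AE x in cantor_measure. False"
    proof (rule AE_mp[OF AE_conjI], intro AE_I2 impI)
      fix x
      assume "(\<exists>G. G \<le>\<^sub>T Collect x \<and> weakly_1_generic A G) \<and> coarse_distance A (Collect x) = 1 / 2"
      then show False using coarse_distance_generic by fastforce
    qed
    then show False using prob_space.AE_False[OF prob_space_cantor] by simp
  qed
qed

end
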